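(* Let $\phi$ be an anisotropic quasilinear $p$-form of dimension $\ge2$ over $F$, and let $s$ be the smallest nonnegative integer such that $p^s\ge i_1(\phi)$. If $\phi$ is not a quasi-Pfister $p$-neighbour, then the first higher anisotropic kernel $\phi_1$ (over $F_1=F(\phi)$) is divisible by an $s$-fold quasi-Pfister $p$-form over $F_1$.
   Context: Let $p$ be a prime and $F$ a field of characteristic $p$. A quasilinear $p$-form over a field $K$ of characteristic $p$ is a map $\phi\colon V\to K$ on a nonzero finite-dimensional $K$-vector space $V$ that is homogeneous of degree $p$ and satisfies $\phi(v+w)=\phi(v)+\phi(w)$; equivalently $\phi\simeq\langle a_1,\dots,a_n\rangle\colon(\lambda_i)\mapsto\sum_i a_i\lambda_i^p$ with $a_i\in K$ not all zero. Notation: $\dim\phi=\dim_KV$; $D(\phi)=\{\phi(v)\}$; $\phi_L$ is scalar extension; $\phi\perp\psi$ orthogonal sum; $(\phi\otimes\psi)(v\otimes w)=\phi(v)\psi(w)$; $a\phi$ is $v\mapsto a\phi(v)$. $\psi\subset\phi$ (subform) if there is an injective linear $f$ with $\phi\circ f=\psi$; similar means $\psi\simeq a\phi$ with $a\in K^*$; $\phi$ is divisible by $\psi$ if $\phi\simeq\psi\otimes\tau$. The isotropy index $i_0(\phi)$ is the dimension of the subspace of vectors with $\phi(v)=0$; anisotropic means $i_0=0$; $\phi_{an}$ is the unique anisotropic form with $D(\phi_{an})=D(\phi)$; $\phi$ is split if $\dim\phi_{an}=1$. The $n$-fold quasi-Pfister $p$-form is $\langle\langle a_1,\dots,a_n\rangle\rangle=\bigotimes_{i=1}^n\langle1,a_i,\dots,a_i^{p-1}\rangle$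 (0-fold: $\langle1\rangle$). For non-split $\phi$, $K(\phi)$ is the function field of the integral hypersurface $\{\phi=0\}\subset\mathbb P(V)$. For anisotropic $\phi$ of dim $\ge2$: $F_1=F(\phi)$, $\phi_1=(\phi_{F_1})_{an}$, $i_1(\phi)=i_0(\phi_{F_1})$. An anisotropic $\phi$ is a quasi-Pfister $p$-neighbour if it is similar to a subform of some quasi-Pfister $p$-form $\pi$ with $\dim\phi>\dim\pi/p$. *)

theory Defs
  imports Main "HOL-Library.Poly_Mapping" "HOL-Computational_Algebra.Primes"
begin

text \<open>A quasilinear p-form of dimension n over a field 'k is represented by its
diagonal coefficient list a = [a_0,...,a_{n-1}] (every quasilinear p-form is
isometric to a diagonal one).  Vectors of k^n are functions nat => 'k of which
only the coordinates below n matter.\<close>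

definition qf_val :: "nat \<Rightarrow> 'k::field list \<Rightarrow> (nat \<Rightarrow> 'k) \<Rightarrow> 'k" where
  "qf_val p a v = (\<Sum>i<length a. a ! i * v i ^ p)"

definition is_qform :: "'k::field list \<Rightarrow> bool" where
  "is_qform a \<longleftrightarrow> a \<noteq> [] \<and> (\<exists>x\<in>set a. x \<noteq> 0)"

definition qf_values :: "nat \<Rightarrow> 'k::field list \<Rightarrow> 'k set" where
  "qf_values p a = {qf_val p a v | v. True}"

definition qf_anisotropic :: "nat \<Rightarrow> 'k::field list \<Rightarrow> bool" where
  "qf_anisotropic p a \<longleftrightarrow> (\<forall>v. qf_val p a v = 0 \<longrightarrow> (\<forall>i<length a. v i = 0))"

definition mat_app :: "nat \<Rightarrow> (nat \<Rightarrow> nat \<Rightarrow> 'k::field) \<Rightarrow> (nat \<Rightarrow> 'k) \<Rightarrow> (nat \<Rightarrow> 'k)" where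
  "mat_app m M v = (\<lambda>i. \<Sum>j<m. M i j * v j)"

definition qf_subform :: "nat \<Rightarrow> 'k::field list \<Rightarrow> 'k list \<Rightarrow> bool" where
  "qf_subform p psi phi \<longleftrightarrow>
     (\<exists>M. (\<forall>v. qf_val p phi (mat_app (length psi) M v) = qf_val p psi v) \<and>
          (\<forall>v. (\<forall>i<length phi. mat_app (length psi) M v i = 0) \<longrightarrow> (\<forall>j<length psi. v j = 0)))"

definition qf_isometric :: "nat \<Rightarrow> 'k::field list \<Rightarrow> 'k list \<Rightarrow> bool" where
  "qf_isometric p psi phi \<longleftrightarrow> length psi = length phi \<and>
     (\<exists>M. (\<forall>v. qf_val p phi (mat_app (length psi) M v) = qf_val p psi v) \<and>
          (\<forall>v. (\<forall>i<length phi. mat_app (length psi) M v i = 0) \<longrightarrow> (\<forall>j<length psi. v j = 0)) \<and>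
          (\<forall>w. \<exists>v. \<forall>i<length phi. mat_app (length psi) M v i = w i))"

definition qf_scale :: "'k::field \<Rightarrow> 'k list \<Rightarrow> 'k list" where
  "qf_scale c a = map (\<lambda>x. c * x) a"

text \<open>Tensor product of diagonal forms: in the basis e_i (x) f_j the form
 v (x) w |-> phi(v) psi(w) has diagonal coefficients a_i * b_j.\<close>
definition qf_tensor :: "'k::field list \<Rightarrow> 'k list \<Rightarrow> 'k list" where
  "qf_tensor a b = concat (map (\<lambda>x. map (\<lambda>y. x * y) b) a)"

definition qpfister :: "nat \<Rightarrow> 'k::field list \<Rightarrow> 'k list" where
  "qpfister p bs = foldr (\<lambda>b acc. qf_tensor (map (\<lambda>k. b ^ k) [0..<p]) acc) bs [1]"

text \<open>Isotropy index: dimension of the subspace {v. phi v = 0}, i.e. the maximal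
number of linearly independent isotropic vectors.\<close>
definition lin_indep :: "nat \<Rightarrow> nat \<Rightarrow> (nat \<Rightarrow> nat \<Rightarrow> 'k::field) \<Rightarrow> bool" where
  "lin_indep n k vs \<longleftrightarrow>
     (\<forall>c. (\<forall>i<n. (\<Sum>j<k. c j * vs j i) = 0) \<longrightarrow> (\<forall>j<k. c j = 0))"

definition qf_i0 :: "nat \<Rightarrow> 'k::field list \<Rightarrow> nat" where
  "qf_i0 p a = Max {k. \<exists>vs. lin_indep (length a) k vs \<and> (\<forall>j<k. qf_val p a (vs j) = 0)}"

definition qp_neighbour :: "nat \<Rightarrow> 'k::field list \<Rightarrow> bool" where
  "qp_neighbour p a \<longleftrightarrow> qf_anisotropic p a \<and>
     (\<exists>bs psi c. c \<noteq> 0 \<and> qf_subform p psi (qpfister p bs) \<and>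
        qf_isometric p a (qf_scale c psi) \<and> length (qpfister p bs) < p * length a)"

type_synonym 'a mpoly = "(nat \<Rightarrow>\<^sub>0 nat) \<Rightarrow>\<^sub>0 'a"

definition mpoly_eval :: "('a \<Rightarrow> 'b::field) \<Rightarrow> (nat \<Rightarrow> 'b) \<Rightarrow> ('a::zero) mpoly \<Rightarrow> 'b" where
  "mpoly_eval \<sigma> \<xi> f = (\<Sum>m\<in>Poly_Mapping.keys f. \<sigma> (Poly_Mapping.lookup f m) * (\<Prod>i\<in>Poly_Mapping.keys (m::nat \<Rightarrow>\<^sub>0 nat). \<xi> i ^ Poly_Mapping.lookup m i))"

definition mpoly_vars_below :: "nat \<Rightarrow> ('a::zero) mpoly \<Rightarrow> bool" where
  "mpoly_vars_below n f \<longleftrightarrow> (\<forall>m\<in>Poly_Mapping.keys f. Poly_Mapping.keys m \<subseteq> {..<n})"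

definition mpoly_homogeneous :: "('a::zero) mpoly \<Rightarrow> bool" where
  "mpoly_homogeneous f \<longleftrightarrow> (\<exists>d. \<forall>m\<in>Poly_Mapping.keys f. (\<Sum>i\<in>Poly_Mapping.keys (m::nat \<Rightarrow>\<^sub>0 nat). Poly_Mapping.lookup m i) = d)"

definition qf_poly :: "nat \<Rightarrow> 'a::field list \<Rightarrow> 'a mpoly" where
  "qf_poly p a = (\<Sum>i<length a. Poly_Mapping.single (Poly_Mapping.single i p) (a ! i))"

definition is_field_hom :: "('a::field \<Rightarrow> 'b::field) \<Rightarrow> bool" where
  "is_field_hom \<sigma> \<longleftrightarrow> \<sigma> 1 = 1 \<and> (\<forall>x y. \<sigma> (x + y) = \<sigma> x + \<sigma> y) \<and> (\<forall>x y. \<sigma> (x * y) = \<sigma> x * \<sigma> y)"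

definition subfield_closed :: "'b::field set \<Rightarrow> bool" where
  "subfield_closed S \<longleftrightarrow> 0 \<in> S \<and> 1 \<in> S \<and> (\<forall>x\<in>S. \<forall>y\<in>S. x + y \<in> S \<and> x * y \<in> S) \<and>
     (\<forall>x\<in>S. - x \<in> S \<and> inverse x \<in> S)"

text \<open>(K, sigma, xi) is the function field F(phi) of the integral projective
hypersurface {phi = 0} in P^{n-1}: sigma : F -> K is a field embedding, xi is a
generic point (a homogeneous polynomial over F in X_0..X_{n-1} vanishes at xi iff
it is divisible by sum a_i X_i^p), and K is generated over sigma(F) by the ratios
xi_i / xi_j, i.e. K is the residue field of the generic point.  This determines K
up to F-isomorphism.\<close>
definition is_function_field :: "nat \<Rightarrow> 'a::field list \<Rightarrow> ('a \<Rightarrow> 'b::field) \<Rightarrow> (nat \<Rightarrow> 'b) \<Rightarrow> bool" where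
  "is_function_field p a \<sigma> \<xi> \<longleftrightarrow> is_field_hom \<sigma> \<and>
     (\<forall>f. mpoly_vars_below (length a) f \<and> mpoly_homogeneous f \<longrightarrow>
          (mpoly_eval \<sigma> \<xi> f = 0 \<longleftrightarrow> qf_poly p a dvd f)) \<and>
     (\<forall>S. subfield_closed S \<and> range \<sigma> \<subseteq> S \<and>
          (\<forall>i<length a. \<forall>j<length a. \<xi> j \<noteq> 0 \<longrightarrow> \<xi> i / \<xi> j \<in> S) \<longrightarrow> S = UNIV)"

end

theory Submission
  imports Defs "HOL-Computational_Algebra.Polynomial"
begin

text \<open>
Write \<open>\<phi> = \<Sum> a\<^sub>i X\<^sub>i\<^sup>p\<close>, let \<open>\<xi>\<close> be the generic zero, \<open>W\<close> the \<open>F\<^sub>1\<^sup>p\<close>-span of the \<open>a\<^sub>i\<close> in \<open>F\<^sub>1\<close>, i.e. the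
value set of \<open>\<phi>\<^sub>1\<close>, and \<open>M = {x. x W \<subseteq> W}\<close>, a field containing \<open>F\<^sub>1\<^sup>p\<close>.  As \<open>W\<close> is a vector space over each
subfield of \<open>M\<close>, it suffices to find \<open>i\<^sub>1(\<phi>)\<close> elements of \<open>M\<close> that are independent over \<open>F\<^sub>1\<^sup>p\<close>.

An isotropic vector is, up to scaling, \<open>(f\<^sub>j(\<xi>))\<close> with \<open>\<Sum> a\<^sub>j f\<^sub>j\<^sup>p = \<phi> g\<close> in \<open>F[X]\<close>.  Differentiating with
respect to \<open>X\<^sub>i\<^sup>p\<close> and evaluating at \<open>\<xi>\<close> gives \<open>a\<^sub>i g(\<xi>) \<in> W\<close> for all \<open>i\<close>, so \<open>g(\<xi>) \<in> M\<close>.  The semilinear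
map \<open>f(\<xi>) \<mapsto> g(\<xi>)\<close> from isotropic vectors to \<open>M\<close> is injective unless \<open>\<Sum> a\<^sub>j f\<^sub>j\<^sup>p = \<phi>\<^sup>k h\<close> for some \<open>f(\<xi>) \<noteq> 0\<close> with
\<open>k \<ge> 2\<close> and \<open>h(\<xi>) \<noteq> 0\<close>; then \<open>k < p\<close>, and \<open>k\<close> differentiations give \<open>w a\<^sub>i a\<^sub>j \<in> W\<close> with a fixed \<open>w \<noteq> 0\<close>, hence all
\<open>a\<^sub>i / a\<^sub>0\<close> lie in \<open>M\<close> and \<open>W\<close> is a multiple of \<open>F\<^sub>1\<^sup>p(a\<^sub>i / a\<^sub>0)\<close>.  Since \<open>F\<^sub>1\<close> has degree \<open>p\<close> over a purely
transcendental extension of \<open>F\<close>, the degree of \<open>F\<^sup>p(a\<^sub>i / a\<^sub>0)\<close> drops at most by the factor \<open>p\<close>, and \<open>\<phi>\<close> is a neighbour.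
\<close>

section \<open>Linear algebra over the p-th powers\<close>

text \<open>Stated for a subfield \<open>S\<close> so that it also counts dimensions over subfields that are not types.\<close>
lemma homogeneous_system_nontrivial_solution:
  fixes A :: "nat \<Rightarrow> nat \<Rightarrow> 'k::field"
  assumes S: "subfield_closed S" and A: "\<And>i j. i < q \<Longrightarrow> j < r \<Longrightarrow> A i j \<in> S" and "q < r"
  shows "\<exists>x. (\<forall>j. x j \<in> S) \<and> (\<exists>j<r. x j \<noteq> 0) \<and> (\<forall>i<q. (\<Sum>j<r. A i j * x j) = 0)"
  using A \<open>q < r\<close>
proof (induction q arbitrary: r A)
  case 0
  then show ?case using S by (intro exI[of _ "\<lambda>j. 1"]) (auto simp: subfield_closed_def)
next
  case (Suc q)
  have S0: "0 \<in> S" and S1: "1 \<in> S" and Sadd: "\<And>x y. x \<in> S \<Longrightarrow> y \<in> S \<Longrightarrow> x + y \<in> S"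
    and Smul: "\<And>x y. x \<in> S \<Longrightarrow> y \<in> S \<Longrightarrow> x * y \<in> S" and Sneg: "\<And>x. x \<in> S \<Longrightarrow> - x \<in> S"
    and Sinv: "\<And>x. x \<in> S \<Longrightarrow> inverse x \<in> S"
    using S by (auto simp: subfield_closed_def)
  have Ssum: "(\<And>j. j \<in> J \<Longrightarrow> f j \<in> S) \<Longrightarrow> sum f J \<in> S" for f :: "nat \<Rightarrow> 'k" and J
    by (induction J rule: infinite_finite_induct) (auto intro: S0 Sadd)
  have Sdiff: "x - y \<in> S" if "x \<in> S" "y \<in> S" for x y
    using Sadd[OF that(1) Sneg[OF that(2)]] by simp
  show ?case
  proof (cases "\<forall>j<r. A q j = 0")
    case True
    have "\<exists>x. (\<forall>j. x j \<in> S) \<and> (\<exists>j<r. x j \<noteq> 0) \<and> (\<forall>i<q. (\<Sum>j<r. A i j * x j) = 0)"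
      using Suc.prems by (intro Suc.IH) auto
    then show ?thesis using True by (auto simp: less_Suc_eq)
  next
    case False
    then obtain t where t: "t < r" "A q t \<noteq> 0" by auto
    \<comment> \<open>Gaussian elimination with pivot \<open>A q t\<close>: \<open>e\<close>
      enumerates the columns other than \<open>t\<close>, and \<open>B\<close> below is the system
      with the pivot column cleared.\<close>
    define e where "e j = (if j < t then j else Suc j)" for j
    obtain r' where r': "r = Suc r'" using Suc.prems by (cases r) auto
    have e: "bij_betw e {..<r'} ({..<r} - {t})"
      unfolding bij_betw_def
    proof
      show "inj_on e {..<r'}" unfolding inj_on_def e_def by auto
      have "j \<in> e ` {..<r'}" if "j < r" "j \<noteq> t" for j
        using that t r' by (intro image_eqI[of _ _ "if j < t then j else j - 1"]) (auto simp: e_def)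
      then have "{..<r} - {t} \<subseteq> e ` {..<r'}" by blast
      moreover have "e ` {..<r'} \<subseteq> {..<r} - {t}"
        unfolding image_subset_iff e_def using r' t by simp
      ultimately show "e ` {..<r'} = {..<r} - {t}" by blast
    qed
    have er: "e j < r" if "j < r'" for j using that r' by (auto simp: e_def)
    define B where "B i j = A i (e j) - A i t * inverse (A q t) * A q (e j)" for i j
    have "\<exists>x. (\<forall>j. x j \<in> S) \<and> (\<exists>j<r'. x j \<noteq> 0) \<and> (\<forall>i<q. (\<Sum>j<r'. B i j * x j) = 0)"
      using Suc.prems r' t er by (intro Suc.IH) (auto simp: B_def intro!: Sdiff Smul Sinv)
    then obtain x where x: "\<And>j. x j \<in> S" "\<exists>j<r'. x j \<noteq> 0" "\<And>i. i < q \<Longrightarrow> (\<Sum>j<r'. B i j * x j) = 0"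
      by blast
    define h where "h = inv_into {..<r'} e"
    \<comment> \<open>Row \<open>q\<close> forces this value of the pivot variable once the others
      are chosen.\<close>
    define s where "s = - (inverse (A q t) * (\<Sum>j<r'. A q (e j) * x j))"
    define y where "y j = (if j = t then s else x (h j))" for j
    have he: "h (e j) = j" if "j < r'" for j
      using that e by (auto simp: h_def bij_betw_def)
    have et: "e j \<noteq> t" for j by (auto simp: e_def)
    have sum: "(\<Sum>j<r. A i j * y j) = A i t * s + (\<Sum>j<r'. A i (e j) * x j)" for i
    proof -
      have "(\<Sum>j<r. A i j * y j) = A i t * y t + (\<Sum>j\<in>{..<r} - {t}. A i j * y j)"
        using t by (intro sum.remove) auto
      also have "(\<Sum>j\<in>{..<r} - {t}. A i j * y j) = (\<Sum>j<r'. A i (e j) * y (e j))"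
        using sum.reindex_bij_betw[OF e, of "\<lambda>j. A i j * y j"] by simp
      also have "\<dots> = (\<Sum>j<r'. A i (e j) * x j)"
        using he et by (intro sum.cong) (auto simp: y_def)
      finally show ?thesis by (simp add: y_def)
    qed
    have "s \<in> S" unfolding s_def using x(1) Suc.prems t er by (intro Sneg Smul Sinv Ssum) auto
    then have "\<forall>j. y j \<in> S" using x(1) by (auto simp: y_def)
    moreover from x(2) obtain j where "j < r'" "x j \<noteq> 0" by auto
    then have "\<exists>j<r. y j \<noteq> 0" using er he et by (intro exI[of _ "e j"]) (auto simp: y_def)
    moreover have "(\<Sum>j<r. A i j * y j) = 0" if "i < Suc q" for i
    proof (cases "i = q")
      case True
      show ?thesis unfolding True sum s_def using t by simp
    next
      case False
      then have "0 = (\<Sum>j<r'. B i j * x j)" using x(3) that by simp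
      also have "\<dots> = (\<Sum>j<r'. A i (e j) * x j) - A i t * inverse (A q t) * (\<Sum>j<r'. A q (e j) * x j)"
        by (simp add: B_def left_diff_distrib sum_subtractf sum_distrib_left mult.assoc)
      also have "\<dots> = (\<Sum>j<r. A i j * y j)" unfolding sum s_def by (simp add: algebra_simps)
      finally show ?thesis by simp
    qed
    ultimately show ?thesis by blast
  qed
qed

lemma subfield_closed_UNIV: "subfield_closed UNIV"
  by (auto simp: subfield_closed_def)

lemma lin_indep_imp_le:
  assumes "lin_indep n k vs" shows "k \<le> n"
proof (rule ccontr)
  assume "\<not> k \<le> n"
  then obtain x where "\<exists>j<k. x j \<noteq> 0" "\<forall>i<n. (\<Sum>j<k. vs j i * x j) = 0"
    using homogeneous_system_nontrivial_solution[OF subfield_closed_UNIV, of n k "\<lambda>i j. vs j i"] by auto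
  then show False using assms unfolding lin_indep_def by (auto simp: mult.commute)
qed

lemma qf_i0_attained:
  "\<exists>vs. lin_indep (length a) (qf_i0 p a) vs \<and> (\<forall>j<qf_i0 p a. qf_val p a (vs j) = 0)"
proof -
  let ?K = "{k. \<exists>vs. lin_indep (length a) k vs \<and> (\<forall>j<k. qf_val p a (vs j) = 0)}"
  have "finite ?K" by (rule finite_subset[of _ "{..length a}"]) (auto dest: lin_indep_imp_le)
  moreover have "0 \<in> ?K" by (auto simp: lin_indep_def)
  ultimately have "Max ?K \<in> ?K" by (intro Max_in) auto
  then show ?thesis by (simp add: qf_i0_def)
qed

lemma sum_lessThan_add:
  fixes f :: "nat \<Rightarrow> 'k::comm_monoid_add"
  shows "sum f {..<m + n} = sum f {..<m} + (\<Sum>i<n. f (m + i))"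
  by (induction n) (auto simp: add.assoc)

lemma qf_val_append:
  "qf_val p (xs @ ys) v = qf_val p xs v + qf_val p ys (\<lambda>i. v (length xs + i))"
  by (simp add: qf_val_def sum_lessThan_add nth_append)

lemma qf_val_cong: "(\<And>i. i < length xs \<Longrightarrow> v i = w i) \<Longrightarrow> qf_val p xs v = qf_val p xs w"
  by (simp add: qf_val_def)

text \<open>The type token \<open>ty\<close> ties the characteristic to one field type, so that the
  base field and the function field can both interpret the locale.\<close>

locale char_p_field =
  fixes p :: nat and ty :: "'k::field itself"
  assumes prime_p: "prime p" and char_p: "CHAR('k) = p"
begin

text \<open>Since the Frobenius is additive, \<open>V xs\<close> is the span of \<open>xs\<close>
  over the field of p-th powers, and anisotropy of \<open>xs\<close> is linear independence over
  that field.\<close>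

abbreviation V :: "'k list \<Rightarrow> 'k set" where "V \<equiv> qf_values p"

lemma p_pos: "p > 0" using prime_p by (rule prime_gt_0_nat)

lemma frob_add: "(x + y :: 'k) ^ p = x ^ p + y ^ p"
  using prime_p char_p by (intro freshmans_dream) auto

lemma frob_sum: "(sum f A :: 'k) ^ p = (\<Sum>i\<in>A. f i ^ p)"
  using prime_p char_p by (intro freshmans_dream_sum) auto

lemma frob_diff: "(x - y :: 'k) ^ p = x ^ p - y ^ p"
  using frob_add[of "x - y" y] by (simp add: algebra_simps)

lemma frob_minus: "(- y :: 'k) ^ p = - (y ^ p)"
  using frob_diff[of 0 y] p_pos by (simp add: power_0_left)

lemma qf_val_add: "qf_val p (xs::'k list) v + qf_val p xs w = qf_val p xs (\<lambda>i. v i + w i)"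
  by (simp add: qf_val_def frob_add sum.distrib algebra_simps)

lemma qf_val_diff: "qf_val p (xs::'k list) v - qf_val p xs w = qf_val p xs (\<lambda>i. v i - w i)"
  by (simp add: qf_val_def frob_diff sum_subtractf algebra_simps)

lemma qf_val_scale: "c ^ p * qf_val p (xs::'k list) v = qf_val p xs (\<lambda>i. c * v i)"
  by (simp add: qf_val_def sum_distrib_left power_mult_distrib algebra_simps)

lemma qf_val_zero: "qf_val p (xs::'k list) (\<lambda>_. 0) = 0"
  using p_pos by (simp add: qf_val_def power_0_left)

lemma V_val: "qf_val p xs v \<in> V xs" by (auto simp: qf_values_def)

lemma V_zero: "0 \<in> V xs" using V_val[of xs "\<lambda>_. 0"] by (simp add: qf_val_zero)

lemma V_add: "x \<in> V xs \<Longrightarrow> y \<in> V xs \<Longrightarrow> x + y \<in> V xs"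
  by (auto simp: qf_values_def qf_val_add)

lemma V_scale: "x \<in> V xs \<Longrightarrow> c ^ p * x \<in> V xs"
  by (auto simp: qf_values_def qf_val_scale)

lemma V_scale_right: "x \<in> V xs \<Longrightarrow> x * c ^ p \<in> V xs"
  using V_scale by (simp add: mult.commute)

lemma V_minus: "x \<in> V xs \<Longrightarrow> - x \<in> V xs"
  using V_scale[of x xs "-1"] by (simp add: frob_minus)

lemma V_sum: "(\<And>i. i \<in> I \<Longrightarrow> f i \<in> V xs) \<Longrightarrow> sum f I \<in> V xs"
  by (induction I rule: infinite_finite_induct) (auto intro: V_zero V_add)

lemma V_mem: assumes "x \<in> set xs" shows "x \<in> V xs"
proof -
  from assms obtain k where k: "k < length xs" "x = xs ! k" by (auto simp: in_set_conv_nth)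
  have "qf_val p xs (\<lambda>i. if i = k then 1 else 0) = (\<Sum>i<length xs. if i = k then xs ! i else 0)"
    unfolding qf_val_def using p_pos by (intro sum.cong) (auto simp: power_0_left)
  also have "\<dots> = x" using k by (simp add: sum.delta)
  finally show ?thesis using V_val by metis
qed

text \<open>The induction principle for membership in a span over the p-th powers.\<close>

lemma V_least:
  assumes "x \<in> V xs" "set xs \<subseteq> U" "0 \<in> U" "\<And>x y. x \<in> U \<Longrightarrow> y \<in> U \<Longrightarrow> x + y \<in> U"
    "\<And>c x. x \<in> U \<Longrightarrow> x * c ^ p \<in> U"
  shows "x \<in> U"
proof -
  obtain v where x: "x = (\<Sum>i<length xs. xs ! i * v i ^ p)"
    using assms(1) by (auto simp: qf_values_def qf_val_def)
  have "(\<Sum>i\<in>I. xs ! i * v i ^ p) \<in> U" if "I \<subseteq> {..<length xs}" for I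
    using that
  proof (induction I rule: infinite_finite_induct)
    case (insert i I)
    then show ?case using assms(2) by (auto intro!: assms(4,5))
  qed (use assms(3) in auto)
  then show ?thesis using x by auto
qed

lemma V_mono: "set xs \<subseteq> V ys \<Longrightarrow> V xs \<subseteq> V ys"
  using V_least[of _ xs "V ys"] V_zero V_add V_scale_right by blast

lemma V_set_cong: "set xs = set ys \<Longrightarrow> V xs = V ys"
  by (intro equalityI V_mono) (auto intro: V_mem)

lemma V_singleton: "V [w] = {w * c ^ p | c. True}"
proof -
  have "qf_val p [w] v = w * v 0 ^ p" for v by (simp add: qf_val_def)
  then show ?thesis unfolding qf_values_def by (auto intro: exI[of _ "\<lambda>_. _"])
qed

lemma qf_val_map_mult: "qf_val p (map ((*) (w::'k)) xs) v = w * qf_val p xs v"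
  by (simp add: qf_val_def sum_distrib_left algebra_simps)

lemma V_map_mult: "V (map ((*) w) xs) = (*) w ` V xs"
  by (auto simp: qf_values_def qf_val_map_mult image_iff)

subsection \<open>Anisotropic lists as bases\<close>

lemma aniso_unique:
  assumes "qf_anisotropic p (xs::'k list)" "qf_val p xs v = qf_val p xs w" "i < length xs"
  shows "v i = w i"
proof -
  have "qf_val p xs (\<lambda>i. v i - w i) = 0" using assms(2) qf_val_diff[of xs v w] by simp
  then show ?thesis using assms(1,3) by (force simp: qf_anisotropic_def)
qed

lemma aniso_append:
  assumes xs: "qf_anisotropic p xs" and ys: "qf_anisotropic p ys" and "V xs \<inter> V ys \<subseteq> {0}"
  shows "qf_anisotropic p (xs @ ys)"
  unfolding qf_anisotropic_def
proof (intro allI impI)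
  fix v i assume v: "qf_val p (xs @ ys) v = 0" and i: "i < length (xs @ ys)"
  let ?w = "\<lambda>i. v (length xs + i)"
  have "qf_val p xs v = - qf_val p ys ?w" using v by (simp add: qf_val_append add_eq_0_iff)
  then have "qf_val p xs v = 0" "qf_val p ys ?w = 0"
    using assms(3) V_val[of xs v] V_minus[OF V_val[of ys ?w]] by force+
  then have "\<forall>i<length xs. v i = 0" "\<forall>i<length ys. v (length xs + i) = 0"
    using xs ys by (auto simp: qf_anisotropic_def)
  then show "v i = 0" using i by (cases "i < length xs") (force dest: spec[of _ "i - length xs"])+
qed

lemma aniso_mult:
  assumes "qf_anisotropic p (xs::'k list)" "w \<noteq> 0" shows "qf_anisotropic p (map ((*) w) xs)"
  using assms by (simp add: qf_anisotropic_def qf_val_map_mult)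

lemma aniso_singleton: "w \<noteq> 0 \<Longrightarrow> qf_anisotropic p [w]"
  using p_pos by (auto simp: qf_anisotropic_def qf_val_def)

lemma aniso_Nil: "qf_anisotropic p []" by (simp add: qf_anisotropic_def)

text \<open>Change of generators: additivity of the Frobenius moves the coordinates along
  \<open>ys\<close> inside the p-th power.\<close>

lemma qf_val_substitute:
  assumes "\<And>j. j < length xs \<Longrightarrow> xs ! j = qf_val p ys (\<lambda>i. A i j)"
  shows "qf_val p (xs::'k list) x = qf_val p ys (\<lambda>i. \<Sum>j<length xs. A i j * x j)"
proof -
  have "qf_val p xs x = (\<Sum>j<length xs. \<Sum>i<length ys. ys ! i * (A i j * x j) ^ p)"
    unfolding qf_val_def[of _ xs]
    by (intro sum.cong)
      (auto simp: assms qf_val_def sum_distrib_left sum_distrib_right power_mult_distrib mult.assoc)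
  also have "\<dots> = (\<Sum>i<length ys. ys ! i * (\<Sum>j<length xs. A i j * x j) ^ p)"
    by (subst sum.swap) (simp add: frob_sum sum_distrib_left)
  finally show ?thesis by (simp add: qf_val_def)
qed

text \<open>With more vectors than generators, the coordinates along \<open>ys\<close> have a
  nontrivial linear relation, which is an isotropic vector for \<open>xs\<close>.\<close>

lemma steinitz:
  assumes "qf_anisotropic p xs" "set xs \<subseteq> V ys" shows "length xs \<le> length ys"
proof (rule ccontr)
  assume *: "\<not> ?thesis"
  have "\<exists>v. xs ! j = qf_val p ys v" if "j < length xs" for j
    using assms(2) nth_mem[OF that] by (auto simp: qf_values_def)
  then obtain B where "\<And>j. j < length xs \<Longrightarrow> xs ! j = qf_val p ys (B j)" by metis
  then obtain A where A: "\<And>j. j < length xs \<Longrightarrow> xs ! j = qf_val p ys (\<lambda>i. A i j)"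
    by (rule that[of "\<lambda>i j. B j i"])
  obtain x where x: "\<exists>j<length xs. x j \<noteq> 0" "\<forall>i<length ys. (\<Sum>j<length xs. A i j * x j) = 0"
    using homogeneous_system_nontrivial_solution[OF subfield_closed_UNIV, of "length ys" "length xs" A] * by auto
  have "qf_val p xs x = qf_val p ys (\<lambda>i. \<Sum>j<length xs. A i j * x j)"
    by (rule qf_val_substitute[OF A])
  also have "\<dots> = 0" using x(2) p_pos by (simp add: power_0_left qf_val_def)
  finally show False using x(1) assms(1) by (auto simp: qf_anisotropic_def)
qed

lemma not_aniso_redundant:
  assumes "\<not> qf_anisotropic p xs"
  shows "\<exists>ys. V xs = V ys \<and> length ys < length xs \<and> set ys \<subseteq> set xs"
proof -
  obtain v k where v: "qf_val p xs v = 0" "k < length xs" "v k \<noteq> 0"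
    using assms by (auto simp: qf_anisotropic_def)
  let ?ys = "take k xs @ drop (Suc k) xs"
  let ?w = "xs ! k"
  have "(\<Sum>i\<in>{..<length xs} - {k}. xs ! i * v i ^ p) \<in> V ?ys"
  proof (intro V_sum V_scale_right V_mem)
    fix i assume i: "i \<in> {..<length xs} - {k}"
    show "xs ! i \<in> set ?ys"
    proof (cases "i < k")
      case True
      then show ?thesis using i v(2) by (auto simp: in_set_conv_nth intro!: exI[of _ i])
    next
      case False
      then have "drop (Suc k) xs ! (i - Suc k) = xs ! i" "i - Suc k < length xs - Suc k"
        using i v(2) by auto
      then show ?thesis by (auto simp: in_set_conv_nth)
    qed
  qed
  moreover have "0 = ?w * v k ^ p + (\<Sum>i\<in>{..<length xs} - {k}. xs ! i * v i ^ p)"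
    using v sum.remove[of "{..<length xs}" k "\<lambda>i. xs ! i * v i ^ p"] by (simp add: qf_val_def)
  ultimately have "?w * v k ^ p \<in> V ?ys" using V_minus by (metis eq_neg_iff_add_eq_0)
  then have "(?w * v k ^ p) * inverse (v k) ^ p \<in> V ?ys" by (rule V_scale_right)
  then have w: "?w \<in> V ?ys" using v by (simp add: field_simps)
  have "xs = take k xs @ ?w # drop (Suc k) xs" using v(2) by (simp add: id_take_nth_drop)
  then have set: "set xs = insert ?w (set ?ys)"
    by (metis Un_insert_right list.simps(15) set_append)
  then have "V xs \<subseteq> V ?ys" using w by (intro V_mono) (auto intro: V_mem)
  moreover have "V ?ys \<subseteq> V xs" using set by (intro V_mono) (auto intro: V_mem)
  ultimately show ?thesis using set v(2) by (intro exI[of _ ?ys]) auto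
qed

lemma aniso_of_length:
  assumes "qf_anisotropic p xs" "V xs \<subseteq> V ys" "length ys \<le> length xs"
  shows "qf_anisotropic p ys"
proof (rule ccontr)
  assume "\<not> ?thesis"
  then obtain zs where "V ys = V zs" "length zs < length ys" using not_aniso_redundant by blast
  then show False using steinitz[OF assms(1), of zs] assms V_mem by fastforce
qed

text \<open>The columns of the matrix are the coordinates of the coefficients of \<open>xs\<close>
  along \<open>ys\<close>; anisotropy of \<open>xs\<close> makes it injective.\<close>

lemma aniso_subform:
  assumes "qf_anisotropic p xs" "V xs \<subseteq> V ys"
  shows "qf_subform p xs ys"
proof -
  have "\<exists>v. xs ! j = qf_val p ys v" if "j < length xs" for j
    using assms(2) V_mem[OF nth_mem[OF that]] by (auto simp: qf_values_def)
  then obtain B where "\<And>j. j < length xs \<Longrightarrow> xs ! j = qf_val p ys (B j)" by metis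
  then obtain M where M: "\<And>j. j < length xs \<Longrightarrow> xs ! j = qf_val p ys (\<lambda>i. M i j)"
    by (rule that[of "\<lambda>i j. B j i"])
  have val: "qf_val p ys (mat_app (length xs) M v) = qf_val p xs v" for v
    unfolding mat_app_def by (rule qf_val_substitute[OF M, symmetric])
  have "v j = 0" if "\<forall>i<length ys. mat_app (length xs) M v i = 0" "j < length xs" for v j
  proof -
    have "qf_val p ys (mat_app (length xs) M v) = qf_val p ys (\<lambda>_. 0)"
      using that(1) by (intro qf_val_cong) auto
    then show ?thesis using val that(2) assms(1) by (auto simp: qf_val_zero qf_anisotropic_def)
  qed
  then show ?thesis unfolding qf_subform_def using val by blast
qed

text \<open>A value of an anisotropic form determines its vector, so equal value sets make the
  embedding surjective.\<close>

lemma aniso_isometric: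
  assumes xs: "qf_anisotropic p xs" and ys: "qf_anisotropic p ys" and V: "V xs = V ys"
  shows "qf_isometric p xs ys"
proof -
  obtain M where M: "\<And>v. qf_val p ys (mat_app (length xs) M v) = qf_val p xs v"
    and inj: "\<forall>v. (\<forall>i<length ys. mat_app (length xs) M v i = 0) \<longrightarrow> (\<forall>j<length xs. v j = 0)"
    using aniso_subform[OF xs] V unfolding qf_subform_def by blast
  have "\<exists>v. \<forall>i<length ys. mat_app (length xs) M v i = w i" for w
  proof -
    obtain v where "qf_val p ys w = qf_val p xs v" using V V_val[of ys w] by (auto simp: qf_values_def)
    then have "qf_val p ys (mat_app (length xs) M v) = qf_val p ys w" using M by simp
    then show ?thesis using aniso_unique[OF ys] by blast
  qed
  moreover have "length xs = length ys"
    using steinitz[OF xs, of ys] steinitz[OF ys, of xs] V V_mem by fastforce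
  ultimately show ?thesis unfolding qf_isometric_def using M inj by blast
qed

end

section \<open>Quasi-Pfister forms and subfields\<close>

lemma subfield_closedD:
  assumes "subfield_closed S"
  shows "0 \<in> S" "1 \<in> S" "x \<in> S \<Longrightarrow> y \<in> S \<Longrightarrow> x + y \<in> S" "x \<in> S \<Longrightarrow> y \<in> S \<Longrightarrow> x * y \<in> S"
    "x \<in> S \<Longrightarrow> - x \<in> S" "x \<in> S \<Longrightarrow> inverse x \<in> S"
    "x \<in> S \<Longrightarrow> y \<in> S \<Longrightarrow> x - y \<in> S" "x \<in> S \<Longrightarrow> y \<in> S \<Longrightarrow> x / y \<in> S"
proof -
  show *: "0 \<in> S" "1 \<in> S" "\<And>x y. x \<in> S \<Longrightarrow> y \<in> S \<Longrightarrow> x + y \<in> S"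
    "\<And>x y. x \<in> S \<Longrightarrow> y \<in> S \<Longrightarrow> x * y \<in> S" "\<And>x. x \<in> S \<Longrightarrow> - x \<in> S" "\<And>x. x \<in> S \<Longrightarrow> inverse x \<in> S"
    using assms by (auto simp: subfield_closed_def)
  show "x \<in> S \<Longrightarrow> y \<in> S \<Longrightarrow> x - y \<in> S" using *(3)[of x "- y"] *(5) by simp
  show "x \<in> S \<Longrightarrow> y \<in> S \<Longrightarrow> x / y \<in> S" using *(4)[of x "inverse y"] *(6) by (simp add: divide_inverse)
qed

lemma subfield_closed_power: "subfield_closed S \<Longrightarrow> x \<in> S \<Longrightarrow> x ^ n \<in> S"
  by (induction n) (auto intro: subfield_closedD)

lemma subfield_closed_sum: "subfield_closed S \<Longrightarrow> (\<And>i. i \<in> I \<Longrightarrow> f i \<in> S) \<Longrightarrow> sum f I \<in> S"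
  by (induction I rule: infinite_finite_induct) (auto intro: subfield_closedD)

text \<open>The division algorithm with all coefficients kept in \<open>N\<close>: cancelling the
  leading term with a multiple of \<open>Q\<close> lowers the degree.\<close>

lemma minimal_degree_dvd:
  fixes Q :: "'k::field poly"
  assumes N: "subfield_closed N"
    and Q: "Q \<noteq> 0" "\<And>i. coeff Q i \<in> N" "poly Q b = 0"
    and min: "\<And>P. P \<noteq> 0 \<Longrightarrow> (\<And>i. coeff P i \<in> N) \<Longrightarrow> poly P b = 0 \<Longrightarrow> degree Q \<le> degree P"
    and P: "\<And>i. coeff P i \<in> N" "poly P b = 0"
  shows "Q dvd P"
  using P
\<comment> \<open>As \<open>degree 0 = 0\<close>, the measure shifts nonzero polynomials by one, so
  that it also drops from a nonzero constant to \<open>0\<close>.\<close>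
proof (induction "if P = 0 then 0 else Suc (degree P)" arbitrary: P rule: less_induct)
  case less
  show ?case
  proof (cases "P = 0")
    case False
    let ?c = "coeff P (degree P) / coeff Q (degree Q)"
    let ?R = "P - monom ?c (degree P - degree Q) * Q"
    have dQ: "degree Q \<le> degree P" using min False less.prems by blast
    have c: "?c \<in> N" "?c \<noteq> 0" using less.prems Q False by (auto intro: subfield_closedD[OF N])
    have "coeff ?R i \<in> N" for i
      using less.prems(1) Q(2) c(1) by (auto simp: coeff_monom_mult intro!: subfield_closedD[OF N])
    moreover have "poly ?R b = 0" using less.prems Q(3) by simp
    moreover have deg: "degree (monom ?c (degree P - degree Q) * Q) = degree P"
      using dQ c(2) Q(1) by (simp add: degree_mult_eq degree_monom_eq)
    have "coeff ?R (degree P) = 0"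
      using dQ Q(1) by (simp add: coeff_monom_mult)
    then have "?R = 0 \<or> degree ?R < degree P"
      using degree_diff_le[of P "degree P" "monom ?c (degree P - degree Q) * Q"] deg
        eq_zero_or_degree_less[of ?R "degree P"] by auto
    ultimately have "Q dvd ?R" using less.hyps[of ?R] False by (auto split: if_splits)
    then have "Q dvd ?R + monom ?c (degree P - degree Q) * Q" by (intro dvd_add) auto
    then show ?thesis by simp
  qed simp
qed

context char_p_field
begin

text \<open>\<open>X\<^sup>p - b\<^sup>p = (X - b)\<^sup>p\<close>, so a minimal polynomial \<open>Q\<close> of \<open>b\<close> over \<open>N\<close> is a power of \<open>X - b\<close>;
  if its degree lies strictly between \<open>1\<close> and \<open>p\<close>, then its derivative is nonzero and does not
  vanish at \<open>b\<close>, so the multiplicity of \<open>b\<close> is \<open>1\<close>.\<close>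
lemma power_not_lower_combination:
  fixes b :: 'k
  assumes N: "subfield_closed N" and bp: "b ^ p \<in> N" and b: "b \<notin> N" and k: "k < p"
    and n: "\<And>i. n i \<in> N"
  shows "b ^ k \<noteq> (\<Sum>i<k. n i * b ^ i)"
proof
  assume rel: "b ^ k = (\<Sum>i<k. n i * b ^ i)"
  define J where "J = {P. P \<noteq> 0 \<and> (\<forall>i. coeff P i \<in> N) \<and> poly P b = 0}"
  define P where "P = monom 1 k - (\<Sum>i<k. monom (n i) i)"
  have coP: "coeff P j = (if j = k then 1 else if j < k then - n j else 0)" for j
    by (auto simp: P_def coeff_sum)
  have "poly P b = 0" using rel by (simp add: P_def poly_sum poly_monom)
  moreover have "coeff P k = 1" by (simp add: coP)
  then have "P \<noteq> 0" by auto
  moreover have "coeff P i \<in> N" for i using n by (auto simp: coP intro: subfield_closedD[OF N])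
  ultimately have PJ: "P \<in> J" by (simp add: J_def)
  have degP: "degree P \<le> k" by (intro degree_le) (auto simp: coP)
  define Q where "Q = (ARG_MIN degree P. P \<in> J)"
  have QJ: "Q \<in> J" and Qmin: "R \<in> J \<Longrightarrow> degree Q \<le> degree R" for R
    unfolding Q_def using arg_min_natI[of "\<lambda>P. P \<in> J" P degree, OF PJ]
      arg_min_nat_le[of "\<lambda>P. P \<in> J" _ degree] by blast+
  let ?d = "degree Q"
  have dp: "?d < p" using Qmin[OF PJ] degP k by simp
  have Q: "Q \<noteq> 0" "\<And>i. coeff Q i \<in> N" "poly Q b = 0" using QJ by (auto simp: J_def)
  have d0: "?d \<noteq> 0"
  proof
    assume "?d = 0"
    then obtain c where "Q = [:c:]" by (rule degree_eq_zeroE)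
    then show False using Q by auto
  qed
  let ?L = "[:- b, 1:]"
  have L: "?L ^ p = monom 1 p - [:b ^ p:]"
  proof -
    have "?L = monom 1 1 + [:- b:]" by (simp add: monom_Suc)
    then have "?L ^ p = (monom 1 1 + [:- b:]) ^ p" by (rule arg_cong)
    also have "\<dots> = monom 1 1 ^ p + [:- b:] ^ p"
      using prime_p char_p by (intro freshmans_dream) simp_all
    also have "[:- b:] ^ p = - [:b ^ p:]" by (simp add: poly_const_pow frob_minus)
    finally show ?thesis by (simp add: monom_power)
  qed
  have "Q dvd ?L ^ p"
  proof (rule minimal_degree_dvd[OF N Q])
    show "poly (?L ^ p) b = 0" using p_pos by simp
    show "coeff (?L ^ p) i \<in> N" for i
      unfolding L using bp by (auto simp: coeff_pCons split: nat.split intro!: subfield_closedD[OF N])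
  qed (use Qmin in \<open>auto simp: J_def\<close>)
  then obtain A where A: "?L ^ p = Q * A" by (auto simp: dvd_def)
  have Lp: "?L ^ p \<noteq> 0" by simp
  then have A0: "A \<noteq> 0" using A by auto
  have degs: "p = ?d + degree A"
    using degree_mult_eq[OF Q(1) A0] A degree_linear_power[of "- b" p] by simp
  have "\<not> ?L ^ 2 dvd Q"
  proof
    assume "?L ^ 2 dvd Q"
    then obtain R where R: "Q = ?L ^ 2 * R" by (auto simp: dvd_def)
    have "poly (pderiv Q) b = 0" unfolding R power2_eq_square
      by (simp add: pderiv_mult del: mult_pCons_left mult_pCons_right)
    moreover have "coeff (pderiv Q) i \<in> N" for i
    proof -
      have "of_nat m \<in> N" for m by (induction m) (auto intro: subfield_closedD[OF N])
      then show ?thesis using Q(2) subfield_closedD(4)[OF N] by (metis coeff_pderiv)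
    qed
    moreover have "coeff (pderiv Q) (?d - 1) \<noteq> 0"
      using d0 dp Q(1) char_p
      by (auto simp: coeff_pderiv of_nat_eq_0_iff_char_dvd dest: dvd_imp_le simp flip: of_nat_Suc)
    then have "pderiv Q \<noteq> 0" by auto
    ultimately have "degree Q \<le> degree (pderiv Q)" by (intro Qmin) (auto simp: J_def)
    moreover have "degree (pderiv Q) \<le> ?d - 1"
      by (intro degree_le) (auto simp: coeff_pderiv coeff_eq_0)
    ultimately show False using d0 by linarith
  qed
  then have "order b Q \<le> 1"
    using order_divides[of b 2 Q] Q(1) by auto
  \<comment> \<open>The cofactor \<open>A\<close> has degree \<open>p - ?d\<close> and vanishes at
    \<open>b\<close> to at most that order; with order at most one for \<open>Q\<close> this leaves
    \<open>?d \<le> 1\<close>.\<close>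
  moreover have "p = order b Q + order b A"
    using order_mult[of Q A b] A Lp order_power_n_n[of b p] by simp
  moreover have "order b A \<le> degree A" using order_degree[OF A0] .
  ultimately have d1: "?d = 1" using degs d0 by linarith
  then have "poly Q b = coeff Q 0 + coeff Q 1 * b" by (simp add: poly_altdef)
  moreover have "coeff Q 1 \<noteq> 0" using d1 Q(1) by (metis leading_coeff_0_iff)
  ultimately have "b = - coeff Q 0 / coeff Q 1" using Q(3) by (simp add: field_simps add_eq_0_iff)
  moreover have "- coeff Q 0 / coeff Q 1 \<in> N" using Q(2) by (intro subfield_closedD[OF N])
  ultimately show False using b by simp
qed

text \<open>Says that \<open>V xs\<close> is a subfield: inverses come from products by
  \<open>inverse_via_frob\<close>.\<close>

definition field_list :: "'k list \<Rightarrow> bool" where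
  "field_list xs \<longleftrightarrow> 1 \<in> V xs \<and> (\<forall>x\<in>V xs. \<forall>y\<in>V xs. x * y \<in> V xs)"

lemma field_list_mult: "field_list xs \<Longrightarrow> x \<in> V xs \<Longrightarrow> y \<in> V xs \<Longrightarrow> x * y \<in> V xs"
  by (simp add: field_list_def)

lemma field_list_frob: "field_list xs \<Longrightarrow> c ^ p \<in> V xs"
  using V_scale[of 1 xs c] by (simp add: field_list_def)

text \<open>Writes an inverse as a power times a p-th power, so a ring containing the p-th powers is
  a field.\<close>

lemma inverse_via_frob: assumes "x \<noteq> (0::'k)" shows "inverse x = x ^ (p - 1) * inverse x ^ p"
proof -
  have "x * (x ^ (p - 1) * inverse x ^ p) = x ^ Suc (p - 1) * inverse x ^ p" by (simp add: mult.assoc)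
  also have "\<dots> = 1" using assms p_pos by (simp add: power_inverse)
  finally show ?thesis using assms by (simp add: field_simps)
qed

lemma field_list_power: "field_list xs \<Longrightarrow> x \<in> V xs \<Longrightarrow> x ^ n \<in> V xs"
  by (induction n) (auto simp: field_list_def)

lemma field_list_subfield: assumes "field_list xs" shows "subfield_closed (V xs)"
proof -
  have "inverse x \<in> V xs" if "x \<in> V xs" for x
  proof (cases "x = 0")
    case False
    then show ?thesis
      using inverse_via_frob[OF False] field_list_power[OF assms that] field_list_frob[OF assms]
        field_list_mult[OF assms] by metis
  qed (use that in simp)
  then show ?thesis using assms
    by (auto simp: subfield_closed_def field_list_def intro: V_zero V_add V_minus)
qed

lemma mult_closed_of_generators:
  assumes "\<And>x y. x \<in> set xs \<Longrightarrow> y \<in> set xs \<Longrightarrow> x * y \<in> V xs" "x \<in> V xs" "y \<in> V xs"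
  shows "x * y \<in> V xs"
proof -
  have 1: "x * y \<in> V xs" if "x \<in> set xs" "y \<in> V xs" for x y
  proof -
    have "y \<in> {y. x * y \<in> V xs}"
      using assms(1) that V_scale_right
      by (intro V_least[OF that(2)]) (auto simp: distrib_left V_zero intro: V_add simp flip: mult.assoc)
    then show ?thesis by simp
  qed
  have "x \<in> {x. x * y \<in> V xs}"
  proof (rule V_least[OF assms(2)])
    show "set xs \<subseteq> {x. x * y \<in> V xs}" using 1 assms(3) by auto
    fix c x assume "x \<in> {x. x * y \<in> V xs}"
    then show "x * c ^ p \<in> {x. x * y \<in> V xs}"
      using V_scale_right[of "x * y" xs c] by (simp add: ac_simps)
  qed (auto simp: distrib_right V_zero intro: V_add)
  then show ?thesis by simp
qed

section \<open>Tensor products as vector spaces over value fields\<close>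

lemma set_tensor: "set (qf_tensor a b) = {x * y | x y. x \<in> set a \<and> y \<in> set b}"
  by (auto simp: qf_tensor_def)

lemma length_tensor: "length (qf_tensor a b) = length a * length b"
  by (induction a) (auto simp: qf_tensor_def)

lemma tensor_snoc: "qf_tensor (a @ [w]) b = qf_tensor a b @ map ((*) w) b"
  by (simp add: qf_tensor_def)

lemma V_tensor_commute: "V (qf_tensor a b) = V (qf_tensor b a)"
  by (rule V_set_cong) (force simp: set_tensor mult.commute)

lemma aniso_tensor_commute:
  "qf_anisotropic p (qf_tensor a (b::'k list)) \<Longrightarrow> qf_anisotropic p (qf_tensor b a)"
  by (rule aniso_of_length) (auto simp: V_tensor_commute[of a] length_tensor)

lemma tensor_mult_mem: assumes "x \<in> set a" "y \<in> V b" shows "x * y \<in> V (qf_tensor a b)"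
proof -
  have "V (map ((*) x) b) \<subseteq> V (qf_tensor a b)"
    using assms(1) by (intro V_mono subsetI V_mem) (auto simp: set_tensor)
  then show ?thesis using assms(2) by (auto simp: V_map_mult)
qed

lemma V_tensor_mult:
  assumes b: "field_list b" and x: "x \<in> V (qf_tensor a b)" and n: "n \<in> V b"
  shows "x * n \<in> V (qf_tensor a b)"
proof -
  have "x \<in> {x. x * n \<in> V (qf_tensor a b)}"
  proof (rule V_least[OF x])
    show "set (qf_tensor a b) \<subseteq> {x. x * n \<in> V (qf_tensor a b)}"
      using tensor_mult_mem field_list_mult[OF b V_mem n] by (auto simp: set_tensor mult.assoc)
    fix c x assume "x \<in> {x. x * n \<in> V (qf_tensor a b)}"
    then show "x * c ^ p \<in> {x. x * n \<in> V (qf_tensor a b)}"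
      using V_scale_right[of "x * n" _ c] by (simp add: ac_simps)
  qed (auto simp: distrib_right V_zero intro: V_add)
  then show ?thesis by simp
qed

text \<open>\<open>V (qf_tensor a b)\<close> is a vector space over the field \<open>V b\<close>, so
  the \<open>V b\<close>-line through an outside element \<open>w\<close> meets it only in
  zero.\<close>

lemma aniso_tensor_snoc:
  assumes b: "field_list b" "qf_anisotropic p b" and a: "qf_anisotropic p (qf_tensor a b)"
    and w: "w \<notin> V (qf_tensor a b)"
  shows "qf_anisotropic p (qf_tensor (a @ [w]) b)"
  unfolding tensor_snoc
proof (rule aniso_append[OF a aniso_mult[OF b(2)]])
  show "w \<noteq> 0" using w V_zero by auto
  show "V (qf_tensor a b) \<inter> V (map ((*) w) b) \<subseteq> {0}"
  proof
    fix x assume "x \<in> V (qf_tensor a b) \<inter> V (map ((*) w) b)"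
    then obtain n where x: "x \<in> V (qf_tensor a b)" "n \<in> V b" "x = w * n" by (auto simp: V_map_mult)
    show "x \<in> {0}"
    proof (cases "n = 0")
      case False
      then have "w = x * inverse n" using x by simp
      then show ?thesis
        using V_tensor_mult[OF b(1) x(1)] subfield_closedD(6)[OF field_list_subfield[OF b(1)] x(2)] w
        by simp
    qed (use x in simp)
  qed
qed

abbreviation powers :: "'k \<Rightarrow> nat \<Rightarrow> 'k list" where
  "powers b k \<equiv> map (\<lambda>i. b ^ i) [0..<k]"

lemma V_tensor_powers:
  assumes acc: "field_list acc" and x: "x \<in> V (qf_tensor (powers b k) acc)"
  shows "\<exists>n. (\<forall>i. n i \<in> V acc) \<and> x = (\<Sum>i<k. n i * b ^ i)"
proof -
  let ?U = "{x. \<exists>n. (\<forall>i. n i \<in> V acc) \<and> x = (\<Sum>i<k. n i * b ^ i)}"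
  have "x \<in> ?U"
  proof (rule V_least[OF x])
    show "set (qf_tensor (powers b k) acc) \<subseteq> ?U"
    proof
      fix x assume "x \<in> set (qf_tensor (powers b k) acc)"
      then obtain j y where j: "j < k" "y \<in> set acc" "x = b ^ j * y" by (auto simp: set_tensor)
      have "(\<Sum>i<k. (if i = j then y else 0) * b ^ i) = (\<Sum>i<k. if i = j then y * b ^ j else 0)"
        by (intro sum.cong) auto
      also have "\<dots> = x" using j by (simp add: sum.delta)
      finally show "x \<in> ?U" using V_mem[OF j(2)] V_zero
        by (auto intro!: exI[of _ "\<lambda>i. if i = j then y else 0"])
    qed
    show "0 \<in> ?U" by (auto intro!: exI[of _ "\<lambda>_. 0"] V_zero)
    fix x y assume "x \<in> ?U" "y \<in> ?U"
    then obtain n n' where "\<forall>i. n i \<in> V acc" "\<forall>i. n' i \<in> V acc"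
      "x = (\<Sum>i<k. n i * b ^ i)" "y = (\<Sum>i<k. n' i * b ^ i)" by blast
    then show "x + y \<in> ?U"
      by (auto intro!: exI[of _ "\<lambda>i. n i + n' i"] V_add simp: sum.distrib distrib_right)
  next
    fix c x assume "x \<in> ?U"
    then obtain n where "\<forall>i. n i \<in> V acc" "x = (\<Sum>i<k. n i * b ^ i)" by blast
    then show "x * c ^ p \<in> ?U"
      by (auto intro!: exI[of _ "\<lambda>i. n i * c ^ p"] V_scale_right
          simp: sum_distrib_left sum_distrib_right algebra_simps)
  qed
  then show ?thesis by simp
qed

text \<open>An element outside the field \<open>V acc\<close> has degree \<open>p\<close> over it,
  so each power of \<open>b\<close> below the \<open>p\<close>-th is new.\<close>

lemma aniso_tensor_powers:
  assumes acc: "field_list acc" "qf_anisotropic p acc" and b: "b \<notin> V acc" and k: "k \<le> p"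
  shows "qf_anisotropic p (qf_tensor (powers b k) acc)"
  using k
proof (induction k)
  case 0
  then show ?case by (simp add: qf_tensor_def aniso_Nil)
next
  case (Suc k)
  have "b ^ k \<notin> V (qf_tensor (powers b k) acc)"
    using power_not_lower_combination[OF field_list_subfield[OF acc(1)] field_list_frob[OF acc(1)] b]
      V_tensor_powers[OF acc(1)] Suc.prems by force
  then show ?case using aniso_tensor_snoc[OF acc] Suc by simp
qed

lemma field_list_tensor_powers:
  assumes acc: "field_list acc" shows "field_list (qf_tensor (powers b p) acc)"
proof -
  let ?T = "qf_tensor (powers b p) acc"
  \<comment> \<open>Exponents reduce modulo \<open>p\<close>, because \<open>b ^ p\<close> is a
    scalar of the span.\<close>
  have pow: "b ^ k * y \<in> V ?T" if "y \<in> V acc" for k y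
  proof -
    have "b ^ (k mod p) * y \<in> V ?T" using that p_pos by (intro tensor_mult_mem) auto
    then have "b ^ (k mod p) * y * (b ^ (k div p)) ^ p \<in> V ?T" by (rule V_scale_right)
    moreover have "b ^ k = b ^ (k mod p) * (b ^ (k div p)) ^ p"
      by (simp flip: power_mult power_add)
    ultimately show ?thesis by (simp add: ac_simps)
  qed
  have "x * y \<in> V ?T" if "x \<in> V ?T" "y \<in> V ?T" for x y
  proof (rule mult_closed_of_generators[OF _ that])
    fix x y assume "x \<in> set ?T" "y \<in> set ?T"
    then obtain i j u v where "x = b ^ i * u" "y = b ^ j * v" "u \<in> set acc" "v \<in> set acc"
      by (auto simp: set_tensor)
    then show "x * y \<in> V ?T"
      using pow[OF field_list_mult[OF acc V_mem V_mem], of u v "i + j"] by (simp add: power_add ac_simps)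
  qed
  then show ?thesis using pow[of 1 0] acc by (auto simp: field_list_def)
qed

section \<open>Quasi-Pfister forms and their value fields\<close>

lemma qpfister_Cons: "qpfister p (b # bs) = qf_tensor (powers b p) (qpfister p bs)"
  by (simp add: qpfister_def)

lemma qpfister_Nil: "qpfister p [] = [1::'k]"
  by (simp add: qpfister_def)

lemma length_qpfister: "length (qpfister p (bs::'k list)) = p ^ length bs"
  by (induction bs) (auto simp: qpfister_Nil qpfister_Cons length_tensor)

lemma field_list_qpfister: "field_list (qpfister p bs)"
proof (induction bs)
  case Nil
  show ?case unfolding qpfister_Nil field_list_def V_singleton
    by (auto simp: power_mult_distrib intro: exI[of _ "1"] exI[of _ "_ * _"])
qed (simp add: qpfister_Cons field_list_tensor_powers)

lemma aniso_qpfister_Cons: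
  "qf_anisotropic p (qpfister p bs) \<Longrightarrow> b \<notin> V (qpfister p bs) \<Longrightarrow> qf_anisotropic p (qpfister p (b # bs))"
  unfolding qpfister_Cons by (rule aniso_tensor_powers[OF field_list_qpfister]) auto

lemma aniso_qpfister_Nil: "qf_anisotropic p (qpfister p ([]::'k list))"
  unfolding qpfister_Nil by (rule aniso_singleton) simp

lemma qpfister_subset_subfield:
  "subfield_closed S \<Longrightarrow> set bs \<subseteq> S \<Longrightarrow> set (qpfister p (bs::'k list)) \<subseteq> S"
  by (induction bs)
    (auto simp: qpfister_Nil qpfister_Cons set_tensor intro!: subfield_closedD(2,4) subfield_closed_power)

text \<open>A generator is kept only if the field built so far does not contain it, which keeps the
  Pfister form anisotropic.\<close>

lemma qpfister_cover:
  "\<exists>bs. set bs \<subseteq> set cs \<and> qf_anisotropic p (qpfister p bs) \<and> set cs \<subseteq> V (qpfister p (bs::'k list))"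
proof (induction cs)
  case Nil
  show ?case using aniso_qpfister_Nil by (intro exI[of _ "[]"]) auto
next
  case (Cons b cs)
  then obtain bs where bs: "set bs \<subseteq> set cs" "qf_anisotropic p (qpfister p bs)" "set cs \<subseteq> V (qpfister p bs)"
    by blast
  show ?case
  proof (cases "b \<in> V (qpfister p bs)")
    case False
    have acc: "y \<in> V (qpfister p (b # bs))" if "y \<in> V (qpfister p bs)" for y
      using tensor_mult_mem[of 1 "powers b p" y "qpfister p bs"] that p_pos
      by (force simp: qpfister_Cons image_iff intro: bexI[of _ 0])
    have "b ^ 1 \<in> set (powers b p)"
      unfolding set_map by (rule imageI) (use prime_gt_1_nat[OF prime_p] in simp)
    then have "b ^ 1 * 1 \<in> V (qpfister p (b # bs))"
      using field_list_qpfister[of bs] unfolding qpfister_Cons field_list_def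
      by (intro tensor_mult_mem) auto
    then show ?thesis using aniso_qpfister_Cons[OF bs(2) False] bs acc
      by (intro exI[of _ "b # bs"]) auto
  qed (use bs in \<open>auto intro!: exI[of _ bs]\<close>)
qed

text \<open>The value field of a form with \<open>t\<close> slots has dimension at most
  \<open>p ^ t\<close> over the p-th powers; while \<open>p ^ t < length zs\<close> it cannot
  contain the independent list \<open>zs\<close>, and a missing entry serves as the next
  slot.\<close>

lemma qpfister_in_subfield:
  assumes S: "subfield_closed (S::'k set)" and zs: "qf_anisotropic p zs" "set zs \<subseteq> S"
    and t: "\<And>i. i < t \<Longrightarrow> p ^ i < length zs"
  shows "\<exists>bs. length bs = t \<and> set bs \<subseteq> S \<and> qf_anisotropic p (qpfister p bs)"
  using t
proof (induction t)
  case 0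
  then show ?case using aniso_qpfister_Nil by auto
next
  case (Suc t)
  then obtain bs where bs: "length bs = t" "set bs \<subseteq> S" "qf_anisotropic p (qpfister p bs)" by auto
  have "\<not> set zs \<subseteq> V (qpfister p bs)"
    using steinitz[OF zs(1)] Suc.prems[of t] bs(1) by (force simp: length_qpfister)
  then obtain b where "b \<in> S" "b \<notin> V (qpfister p bs)" using zs(2) by auto
  then show ?case using bs aniso_qpfister_Cons by (intro exI[of _ "b # bs"]) auto
qed

text \<open>A longest list in \<open>V ws\<close> that is independent over the field
  \<open>V b\<close> must span; \<open>length ws\<close> bounds its length.\<close>

lemma field_list_module_basis:
  assumes b: "field_list b" "qf_anisotropic p b"
    and W: "\<And>x w. x \<in> V b \<Longrightarrow> w \<in> V ws \<Longrightarrow> w * x \<in> V ws"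
  shows "\<exists>\<tau>. qf_anisotropic p (qf_tensor \<tau> b) \<and> V (qf_tensor \<tau> b) = V ws"
proof -
  let ?T = "\<lambda>\<tau>. qf_anisotropic p (qf_tensor \<tau> b) \<and> set \<tau> \<subseteq> V ws"
  have sub: "V (qf_tensor \<tau> b) \<subseteq> V ws" if "set \<tau> \<subseteq> V ws" for \<tau>
    using that W V_mem by (intro V_mono) (auto simp: set_tensor)
  have "b \<noteq> []" using b(1) by (auto simp: field_list_def qf_values_def qf_val_def)
  have bound: "length \<tau> \<le> length ws" if "?T \<tau>" for \<tau>
  proof -
    have "length (qf_tensor \<tau> b) \<le> length ws"
      using that sub[of \<tau>] V_mem by (intro steinitz) auto
    then have "length \<tau> * length b \<le> length ws" by (simp add: length_tensor)
    then show ?thesis using \<open>b \<noteq> []\<close> by (cases "length b") auto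
  qed
  have T0: "?T []" by (simp add: qf_tensor_def aniso_Nil)
  define \<tau> where "\<tau> = (ARG_MAX length \<tau>. ?T \<tau>)"
  have T: "?T \<tau>" and Tmax: "?T \<rho> \<Longrightarrow> length \<rho> \<le> length \<tau>" for \<rho>
    unfolding \<tau>_def using T0 bound
    by (metis (no_types, lifting) arg_max_natI less_Suc_eq_le,
        metis (no_types, lifting) arg_max_nat_le less_Suc_eq_le)
  have "V ws \<subseteq> V (qf_tensor \<tau> b)"
  proof
    fix w assume w: "w \<in> V ws"
    show "w \<in> V (qf_tensor \<tau> b)"
    proof (rule ccontr)
      assume "w \<notin> V (qf_tensor \<tau> b)"
      then have "?T (\<tau> @ [w])" using aniso_tensor_snoc[OF b] T w by auto
      then show False using Tmax by fastforce
    qed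
  qed
  then show ?thesis using T sub by blast
qed

end

section \<open>Multivariate polynomials\<close>

lemma mpoly_induct [case_names single add]:
  fixes f :: "'i \<Rightarrow>\<^sub>0 'c::comm_monoid_add"
  assumes "\<And>m c. P (Poly_Mapping.single m c)" "\<And>f g. P f \<Longrightarrow> P g \<Longrightarrow> P (f + g)"
  shows "P f"
proof -
  have "P (\<Sum>m\<in>A. Poly_Mapping.single m (Poly_Mapping.lookup f m))" if "finite A" for A
    using that
  proof (induction A rule: finite_induct)
    case empty
    then show ?case using assms(1)[of undefined 0] by simp
  qed (use assms in auto)
  moreover have "f = (\<Sum>m\<in>Poly_Mapping.keys f. Poly_Mapping.single m (Poly_Mapping.lookup f m))"
    by (rule poly_mapping_eqI)
      (simp add: lookup_sum lookup_single when_def sum.delta' in_keys_iff)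
  ultimately show ?thesis by (metis finite_keys)
qed

lemma lookup_nat_add_keys: "Poly_Mapping.keys ((m :: 'i \<Rightarrow>\<^sub>0 nat) + n) = Poly_Mapping.keys m \<union> Poly_Mapping.keys n"
  by (auto simp: in_keys_iff lookup_add)

lemma add_diff_poly_mapping:
  fixes m k :: "'i \<Rightarrow>\<^sub>0 nat"
  assumes "q \<le> Poly_Mapping.lookup m i"
  shows "Poly_Mapping.single i q + (m - Poly_Mapping.single i q) = m"
  using assms by (intro poly_mapping_eqI) (auto simp: lookup_add lookup_minus lookup_single when_def)

lemma lookup_single_mult:
  fixes g :: "'a::comm_semiring_0 mpoly"
  shows "Poly_Mapping.lookup (Poly_Mapping.single (Poly_Mapping.single i q) c * g) m =
    (if q \<le> Poly_Mapping.lookup m i then c * Poly_Mapping.lookup g (m - Poly_Mapping.single i q) else 0)"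
proof (induction g rule: mpoly_induct)
  case (single n d)
  have "Poly_Mapping.single i q + n = m \<longleftrightarrow>
    q \<le> Poly_Mapping.lookup m i \<and> n = m - Poly_Mapping.single i q"
    using add_diff_poly_mapping[of q m i]
    by (auto simp: lookup_add)
  then show ?case by (auto simp: mult_single lookup_single when_def)
qed (simp_all add: distrib_left lookup_add)

abbreviation mconst :: "'a::zero \<Rightarrow> 'a mpoly" where "mconst c \<equiv> Poly_Mapping.single 0 c"

lemma lookup_const_mult:
  fixes g :: "'a::comm_semiring_0 mpoly"
  shows "Poly_Mapping.lookup (mconst c * g) m = c * Poly_Mapping.lookup g m"
  \<comment> \<open>With exponent \<open>0\<close> the monomial is \<open>0\<close> whatever the
    variable, so \<open>undefined\<close> serves as index.\<close>
  using lookup_single_mult[of undefined 0 c g m] by simp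

subsection \<open>Evaluation\<close>

lemma field_homD:
  assumes "is_field_hom \<sigma>"
  shows "\<sigma> 1 = 1" "\<sigma> (x + y) = \<sigma> x + \<sigma> y" "\<sigma> (x * y) = \<sigma> x * \<sigma> y" "\<sigma> 0 = 0"
    "\<sigma> (x ^ n) = \<sigma> x ^ n" "\<sigma> (sum g A) = (\<Sum>i\<in>A. \<sigma> (g i))" "\<sigma> x = 0 \<longleftrightarrow> x = 0"
    "\<sigma> (x / y) = \<sigma> x / \<sigma> y"
proof -
  show *: "\<sigma> 1 = 1" "\<And>x y. \<sigma> (x + y) = \<sigma> x + \<sigma> y" "\<And>x y. \<sigma> (x * y) = \<sigma> x * \<sigma> y"
    using assms by (auto simp: is_field_hom_def)
  show 0: "\<sigma> 0 = 0" by (metis *(2) add.right_neutral add_cancel_left_right)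
  show "\<sigma> (x ^ n) = \<sigma> x ^ n" by (induction n) (auto simp: *)
  show "\<sigma> (sum g A) = (\<Sum>i\<in>A. \<sigma> (g i))" by (induction A rule: infinite_finite_induct) (auto simp: * 0)
  show nz: "\<sigma> x = 0 \<longleftrightarrow> x = 0" for x
  proof
    assume "\<sigma> x = 0"
    then show "x = 0" using *(1) *(3)[of x "inverse x"] by (cases "x = 0") auto
  qed (simp add: 0)
  show "\<sigma> (x / y) = \<sigma> x / \<sigma> y"
    using *(3)[of "x / y" y] 0 nz[of y] by (cases "y = 0") (auto simp: field_simps)
qed

lemma field_hom_CHAR:
  fixes \<sigma> :: "'a::field \<Rightarrow> 'b::field"
  assumes "is_field_hom \<sigma>" shows "CHAR('b) = CHAR('a)"
proof -
  have "\<sigma> (of_nat n) = of_nat n" for n by (induction n) (auto simp: field_homD[OF assms])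
  then have "of_nat n = (0::'b) \<longleftrightarrow> of_nat n = (0::'a)" for n
    using field_homD(7)[OF assms, of "of_nat n"] by simp
  then show ?thesis by (intro CHAR_eqI) (auto simp: of_nat_eq_0_iff_char_dvd)
qed

definition mono_eval :: "(nat \<Rightarrow> 'b::field) \<Rightarrow> (nat \<Rightarrow>\<^sub>0 nat) \<Rightarrow> 'b" where
  "mono_eval \<xi> m = (\<Prod>i\<in>Poly_Mapping.keys m. \<xi> i ^ Poly_Mapping.lookup m i)"

lemma mono_eval_superset:
  assumes "finite A" "Poly_Mapping.keys m \<subseteq> A"
  shows "mono_eval \<xi> m = (\<Prod>i\<in>A. \<xi> i ^ Poly_Mapping.lookup m i)"
  unfolding mono_eval_def using assms by (intro prod.mono_neutral_left) (auto simp: in_keys_iff)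

lemma mono_eval_add: "mono_eval \<xi> (m + n) = mono_eval \<xi> m * mono_eval \<xi> n"
proof -
  let ?A = "Poly_Mapping.keys m \<union> Poly_Mapping.keys n"
  have "mono_eval \<xi> k = (\<Prod>i\<in>?A. \<xi> i ^ Poly_Mapping.lookup k i)" if "Poly_Mapping.keys k \<subseteq> ?A" for k
    using that by (intro mono_eval_superset) auto
  then show ?thesis by (simp add: lookup_nat_add_keys lookup_add power_add prod.distrib)
qed

lemma mpoly_eval_alt:
  "mpoly_eval \<sigma> \<xi> f = (\<Sum>m\<in>Poly_Mapping.keys f. \<sigma> (Poly_Mapping.lookup f m) * mono_eval \<xi> m)"
  by (simp add: mpoly_eval_def mono_eval_def)

context
  fixes \<sigma> :: "'a::field \<Rightarrow> 'b::field" and \<xi> :: "nat \<Rightarrow> 'b"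
  assumes hom: "is_field_hom \<sigma>"
begin

lemma mpoly_eval_superset:
  assumes "finite A" "Poly_Mapping.keys f \<subseteq> A"
  shows "mpoly_eval \<sigma> \<xi> f = (\<Sum>m\<in>A. \<sigma> (Poly_Mapping.lookup f m) * mono_eval \<xi> m)"
  unfolding mpoly_eval_alt using assms field_homD(4)[OF hom]
  by (intro sum.mono_neutral_left) (auto simp: in_keys_iff)

lemma mpoly_eval_single: "mpoly_eval \<sigma> \<xi> (Poly_Mapping.single m c) = \<sigma> c * mono_eval \<xi> m"
  by (subst mpoly_eval_superset[of "{m}"]) auto

lemma mpoly_eval_add: "mpoly_eval \<sigma> \<xi> (f + g) = mpoly_eval \<sigma> \<xi> f + mpoly_eval \<sigma> \<xi> g"
proof -
  let ?A = "Poly_Mapping.keys f \<union> Poly_Mapping.keys g"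
  have "mpoly_eval \<sigma> \<xi> h = (\<Sum>m\<in>?A. \<sigma> (Poly_Mapping.lookup h m) * mono_eval \<xi> m)"
    if "Poly_Mapping.keys h \<subseteq> ?A" for h
    using that by (intro mpoly_eval_superset) auto
  then show ?thesis using keys_add[of f g]
    by (simp add: lookup_add field_homD(2)[OF hom] distrib_right sum.distrib)
qed

lemma mpoly_eval_const: "mpoly_eval \<sigma> \<xi> (mconst c) = \<sigma> c"
  by (simp add: mpoly_eval_single mono_eval_def)

lemma mpoly_eval_zero: "mpoly_eval \<sigma> \<xi> 0 = 0"
  by (simp add: mpoly_eval_def)

lemma mpoly_eval_sum: "mpoly_eval \<sigma> \<xi> (sum f A) = (\<Sum>i\<in>A. mpoly_eval \<sigma> \<xi> (f i))"
  by (induction A rule: infinite_finite_induct) (auto simp: mpoly_eval_zero mpoly_eval_add)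

lemma mpoly_eval_mult: "mpoly_eval \<sigma> \<xi> (f * g) = mpoly_eval \<sigma> \<xi> f * mpoly_eval \<sigma> \<xi> g"
proof (induction f rule: mpoly_induct)
  case (single m c)
  show ?case
  proof (induction g rule: mpoly_induct)
    case (single n d)
    show ?case
      by (simp add: mult_single mpoly_eval_single mono_eval_add field_homD(3)[OF hom])
  qed (simp add: distrib_left mpoly_eval_add)
qed (simp add: distrib_right mpoly_eval_add)

lemma mpoly_eval_one: "mpoly_eval \<sigma> \<xi> 1 = 1"
  using mpoly_eval_const[of 1] by (simp add: field_homD(1)[OF hom])

lemma mpoly_eval_power: "mpoly_eval \<sigma> \<xi> (f ^ n) = mpoly_eval \<sigma> \<xi> f ^ n"
  by (induction n) (auto simp: mpoly_eval_one mpoly_eval_mult)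

lemma mpoly_eval_var: "mpoly_eval \<sigma> \<xi> (Poly_Mapping.single (Poly_Mapping.single i 1) 1) = \<xi> i"
  by (simp add: mpoly_eval_single mono_eval_def field_homD(1)[OF hom])

end

subsection \<open>Homogeneous polynomials in given variables\<close>

definition mono_degree :: "(nat \<Rightarrow>\<^sub>0 nat) \<Rightarrow> nat" where
  "mono_degree m = (\<Sum>i\<in>Poly_Mapping.keys m. Poly_Mapping.lookup m i)"

lemma mono_degree_single: "mono_degree (Poly_Mapping.single i q) = q"
  by (simp add: mono_degree_def)

lemma mono_degree_add: "mono_degree (m + n) = mono_degree m + mono_degree n"
proof -
  let ?A = "Poly_Mapping.keys m \<union> Poly_Mapping.keys n"
  have "mono_degree k = (\<Sum>i\<in>?A. Poly_Mapping.lookup k i)" if "Poly_Mapping.keys k \<subseteq> ?A" for k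
    unfolding mono_degree_def using that by (intro sum.mono_neutral_left) (auto simp: in_keys_iff)
  then show ?thesis by (simp add: lookup_nat_add_keys lookup_add sum.distrib)
qed

definition homog :: "nat set \<Rightarrow> nat \<Rightarrow> 'a::zero mpoly \<Rightarrow> bool" where
  "homog I d f \<longleftrightarrow> (\<forall>m\<in>Poly_Mapping.keys f. Poly_Mapping.keys m \<subseteq> I \<and> mono_degree m = d)"

lemma homog_imp_mpoly:
  assumes "homog I d f" "I \<subseteq> {..<n}" shows "mpoly_vars_below n f \<and> mpoly_homogeneous f"
  using assms unfolding homog_def mpoly_vars_below_def mpoly_homogeneous_def mono_degree_def by blast

lemma homog_mono: "homog I d f \<Longrightarrow> I \<subseteq> J \<Longrightarrow> homog J d f"
  unfolding homog_def by blast

lemma homog_zero: "homog I d 0" by (simp add: homog_def)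

lemma homog_single:
  "Poly_Mapping.keys m \<subseteq> I \<Longrightarrow> mono_degree m = d \<Longrightarrow> homog I d (Poly_Mapping.single m c)"
  by (simp add: homog_def)

lemma homog_const: "homog I 0 (mconst c)"
  by (rule homog_single) (auto simp: mono_degree_def)

lemma homog_add: "homog I d f \<Longrightarrow> homog I d g \<Longrightarrow> homog I d (f + g)"
  using keys_add[of f g] by (auto simp: homog_def)

lemma homog_sum: "(\<And>i. i \<in> A \<Longrightarrow> homog I d (f i)) \<Longrightarrow> homog I d (sum f A)"
  by (induction A rule: infinite_finite_induct) (auto intro: homog_zero homog_add)

lemma homog_mult: "homog I d f \<Longrightarrow> homog I e g \<Longrightarrow> homog I (d + e) (f * g)"
  using keys_mult[of f g] unfolding homog_def
  by (force simp: mono_degree_add lookup_nat_add_keys)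

lemma homog_power: "homog I d f \<Longrightarrow> homog I (n * d) (f ^ n)"
  for f :: "'a::comm_semiring_1 mpoly"
proof (induction n)
  case 0
  show ?case using homog_const[of I "1::'a"] by simp
qed (auto dest: homog_mult)

lemma homog_const_mult: "homog I d f \<Longrightarrow> homog I d (mconst c * f)"
  using homog_mult[OF homog_const] by fastforce

section \<open>Components of prescribed degree\<close>

lift_definition mrestrict :: "('i \<Rightarrow> bool) \<Rightarrow> ('i \<Rightarrow>\<^sub>0 'c::zero) \<Rightarrow> ('i \<Rightarrow>\<^sub>0 'c)"
  is "\<lambda>P f m. if P m then f m else 0"
  by (auto elim: finite_subset[rotated])

lemma keys_mrestrict: "m \<in> Poly_Mapping.keys (mrestrict P f) \<Longrightarrow> P m"
  by (simp add: in_keys_iff mrestrict.rep_eq split: if_splits)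

lemma mrestrict_add: "mrestrict P (f + g) = mrestrict P f + mrestrict P (g :: 'i \<Rightarrow>\<^sub>0 'c::comm_monoid_add)"
  by (rule poly_mapping_eqI) (simp add: mrestrict.rep_eq lookup_add)

lemma mrestrict_single: "mrestrict P (Poly_Mapping.single m c) = (if P m then Poly_Mapping.single m c else 0)"
  by (rule poly_mapping_eqI) (auto simp: mrestrict.rep_eq lookup_single when_def)

lemma mrestrict_id: "(\<And>m. m \<in> Poly_Mapping.keys f \<Longrightarrow> P m) \<Longrightarrow> mrestrict P f = f"
  by (rule poly_mapping_eqI) (auto simp: mrestrict.rep_eq in_keys_iff)

lemma mrestrict_sum:
  "mrestrict P (sum f A) = (\<Sum>i\<in>A. mrestrict P (f i :: 'i \<Rightarrow>\<^sub>0 'c::comm_monoid_add))"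
proof (induction A rule: infinite_finite_induct)
  case (insert x F)
  then show ?case by (simp add: mrestrict_add)
qed (auto intro!: poly_mapping_eqI simp: mrestrict.rep_eq)

text \<open>\<open>e\<close> is the amount by which the degree falls short of \<open>d\<close>; subtracting it from \<open>d\<close> would truncate.\<close>
definition codegree_part :: "nat \<Rightarrow> nat \<Rightarrow> nat \<Rightarrow> 'a::zero mpoly \<Rightarrow> 'a mpoly" where
  "codegree_part n d e = mrestrict (\<lambda>m. Poly_Mapping.keys m \<subseteq> {..<n} \<and> mono_degree m + e = d)"

lemma homog_codegree_part: "homog {..<n} (d - e) (codegree_part n d e f)"
  unfolding homog_def codegree_part_def by (force dest: keys_mrestrict)

lemma homog_qf_poly: "homog {..<length a} p (qf_poly p a)"
  unfolding qf_poly_def by (intro homog_sum homog_single) (auto simp: mono_degree_single)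

text \<open>Every term of \<open>qf_poly p a\<close> has degree \<open>p\<close>, so a component of
  the product comes from the component of \<open>g\<close> lying \<open>p\<close> degrees
  lower.\<close>

lemma codegree_part_qf_poly_mult:
  fixes g :: "'a::field mpoly"
  shows "codegree_part (length a) d e (qf_poly p a * g) = qf_poly p a * codegree_part (length a) d (e + p) g"
proof -
  have "codegree_part (length a) d e (Poly_Mapping.single (Poly_Mapping.single i p) c * g) =
    Poly_Mapping.single (Poly_Mapping.single i p) c * codegree_part (length a) d (e + p) g"
    if "i < length a" for i c
  proof (induction g rule: mpoly_induct)
    case (single m b)
    then show ?case using that
      by (auto simp: codegree_part_def mult_single mrestrict_single lookup_nat_add_keys
          mono_degree_add mono_degree_single algebra_simps)
  qed (simp add: distrib_left codegree_part_def mrestrict_add)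
  then show ?thesis
    by (simp add: qf_poly_def sum_distrib_right codegree_part_def mrestrict_sum)
qed

lemma codegree_part_qf_poly_power_mult:
  fixes g :: "'a::field mpoly"
  shows "codegree_part (length a) d e (qf_poly p a ^ k * g) =
    qf_poly p a ^ k * codegree_part (length a) d (e + k * p) g"
proof (induction k arbitrary: e)
  case (Suc k)
  show ?case
    by (simp only: power_Suc mult.assoc codegree_part_qf_poly_mult Suc mult_Suc add.assoc)
qed simp

text \<open>The given cofactor may be inhomogeneous or involve further variables; its component of
  the right degree does the same job. If \<open>k * p\<close> exceeds \<open>d\<close>, that
  component is zero.\<close>

lemma homog_quotient:
  fixes f g :: "'a::field mpoly"
  assumes "homog {..<length a} d f" "f = qf_poly p a ^ k * g"
  shows "\<exists>g'. homog {..<length a} (d - k * p) g' \<and> f = qf_poly p a ^ k * g'"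
proof -
  have "f = codegree_part (length a) d 0 f"
    unfolding codegree_part_def using assms(1) by (subst mrestrict_id) (auto simp: homog_def)
  also have "\<dots> = qf_poly p a ^ k * codegree_part (length a) d (k * p) g"
    unfolding assms(2) by (simp add: codegree_part_qf_poly_power_mult)
  finally show ?thesis using homog_codegree_part by blast
qed

text \<open>If \<open>D\<close> is the largest exponent of the first variable in \<open>g\<close>,
  the product contains a monomial with exponent \<open>D + p\<close> there.\<close>

lemma qf_poly_mult_without_first_var:
  fixes g :: "'a::field mpoly"
  assumes a: "a \<noteq> []" "a ! 0 \<noteq> 0" and p: "p > 0"
    and no0: "\<And>m. m \<in> Poly_Mapping.keys (qf_poly p a * g) \<Longrightarrow> Poly_Mapping.lookup m 0 = 0"
  shows "g = 0"
proof (rule ccontr)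
  assume "g \<noteq> 0"
  then have ne: "Poly_Mapping.keys g \<noteq> {}" by simp
  define D where "D = Max ((\<lambda>m. Poly_Mapping.lookup m 0) ` Poly_Mapping.keys g)"
  have "D \<in> (\<lambda>m. Poly_Mapping.lookup m 0) ` Poly_Mapping.keys g"
    unfolding D_def using ne by (intro Max_in) auto
  then obtain m where m: "m \<in> Poly_Mapping.keys g" "Poly_Mapping.lookup m 0 = D" by auto
  have max: "Poly_Mapping.lookup k 0 \<le> D" if "k \<in> Poly_Mapping.keys g" for k
    unfolding D_def using that by (intro Max_ge) auto
  let ?n = "m + Poly_Mapping.single 0 p"
  have "Poly_Mapping.lookup (Poly_Mapping.single (Poly_Mapping.single i p) (a ! i) * g) ?n
    = (if i = 0 then a ! 0 * Poly_Mapping.lookup g m else 0)" for i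
  proof (cases "i = 0")
    case False
    \<comment> \<open>For \<open>i\<close> other than \<open>0\<close> the monomial of
      \<open>g\<close> would need exponent \<open>D + p\<close> in the first variable, more than the
      maximum.\<close>
    then have "Poly_Mapping.lookup (?n - Poly_Mapping.single i p) 0 = D + p"
      using m(2) by (simp add: lookup_minus lookup_add lookup_single)
    then have "?n - Poly_Mapping.single i p \<notin> Poly_Mapping.keys g" using max p by fastforce
    then show ?thesis using False by (simp add: lookup_single_mult in_keys_iff)
  qed (simp add: lookup_single_mult lookup_add)
  then have "Poly_Mapping.lookup (qf_poly p a * g) ?n = a ! 0 * Poly_Mapping.lookup g m"
    using a(1) by (simp add: qf_poly_def sum_distrib_right lookup_sum sum.delta)
  then have "?n \<in> Poly_Mapping.keys (qf_poly p a * g)" using a m(1) by (simp add: in_keys_iff)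
  then show False using no0 p by (fastforce simp: lookup_add)
qed

subsection \<open>Differentiation with respect to \<open>X\<^sub>i\<^sup>q\<close>\<close>

text \<open>On monomials, \<open>X\<^sup>m \<mapsto> (m\<^sub>i div q) X\<^sup>m / X\<^sub>i\<^sup>q\<close>.  The Leibniz rule holds only for products with a factor
  in \<open>F[X\<^sup>q]\<close>.\<close>
lift_definition qderiv :: "nat \<Rightarrow> nat \<Rightarrow> 'a::comm_semiring_1 mpoly \<Rightarrow> 'a mpoly"
  is "\<lambda>q i f m. of_nat (Poly_Mapping.lookup m i div q + 1) * f (m + Poly_Mapping.single i q)"
proof -
  fix q i and f :: "(nat \<Rightarrow>\<^sub>0 nat) \<Rightarrow> 'a"
  assume "finite {x. f x \<noteq> 0}"
  then have "finite ((\<lambda>m. m + Poly_Mapping.single i q) -` {x. f x \<noteq> 0})"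
    by (rule finite_vimageI) (simp add: inj_on_def)
  then show "finite {m. of_nat (Poly_Mapping.lookup m i div q + 1) * f (m + Poly_Mapping.single i q) \<noteq> 0}"
    by (rule finite_subset[rotated]) auto
qed

lemma qderiv_add: "qderiv q i (f + g) = qderiv q i f + qderiv q i g"
  by (rule poly_mapping_eqI) (simp add: qderiv.rep_eq lookup_add distrib_left)

lemma qderiv_sum: "qderiv q i (sum f A) = (\<Sum>x\<in>A. qderiv q i (f x))"
proof (induction A rule: infinite_finite_induct)
  case (insert x F)
  then show ?case by (simp add: qderiv_add)
qed (auto intro!: poly_mapping_eqI simp: qderiv.rep_eq)

text \<open>Truncated subtraction does no harm: if the exponent of variable \<open>i\<close> is
  below \<open>q\<close>, then \<open>div\<close> makes the coefficient zero.\<close>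

lemma qderiv_single:
  assumes "q > 0"
  shows "qderiv q i (Poly_Mapping.single m c) =
    Poly_Mapping.single (m - Poly_Mapping.single i q) (of_nat (Poly_Mapping.lookup m i div q) * c)"
proof (rule poly_mapping_eqI)
  fix k
  show "Poly_Mapping.lookup (qderiv q i (Poly_Mapping.single m c)) k = Poly_Mapping.lookup
    (Poly_Mapping.single (m - Poly_Mapping.single i q) (of_nat (Poly_Mapping.lookup m i div q) * c)) k"
  proof (cases "m = k + Poly_Mapping.single i q")
    case True
    then show ?thesis using assms by (simp add: qderiv.rep_eq lookup_add)
  next
    case False
    have "Poly_Mapping.lookup m i div q = 0" if "m - Poly_Mapping.single i q = k"
      using False that add_diff_poly_mapping[of q m i] by (force simp: add.commute)
    then show ?thesis using False by (auto simp: qderiv.rep_eq lookup_single when_def)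
  qed
qed

lemma qderiv_const_mult: "qderiv q i (mconst c * g) = mconst c * qderiv q i g"
  by (rule poly_mapping_eqI) (simp add: qderiv.rep_eq lookup_const_mult mult.left_commute)

lemma qderiv_var_power_mult:
  assumes q: "q > 0"
  shows "qderiv q i (Poly_Mapping.single (Poly_Mapping.single k q) c * g) =
    (if k = i then mconst c * g else 0) + Poly_Mapping.single (Poly_Mapping.single k q) c * qderiv q i g"
proof (induction g rule: mpoly_induct)
  case (single m d)
  show ?case
  proof (cases "k = i")
    case True
    show ?thesis
    proof (cases "q \<le> Poly_Mapping.lookup m i")
      case qm: True
      show ?thesis using q True add_diff_poly_mapping[OF qm]
        by (simp add: mult_single qderiv_single lookup_add algebra_simps flip: single_add)
    next
      case False
      then show ?thesis using q True
        by (simp add: mult_single qderiv_single lookup_add)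
    qed
  next
    case False
    have "Poly_Mapping.single k q + m - Poly_Mapping.single i q
      = Poly_Mapping.single k q + (m - Poly_Mapping.single i q)"
      using False by (intro poly_mapping_eqI) (auto simp: lookup_add lookup_minus lookup_single when_def)
    then show ?thesis using q False
      by (simp add: mult_single qderiv_single lookup_add lookup_single algebra_simps)
  qed
qed (simp add: qderiv_add distrib_left algebra_simps)

lemma qderiv_qf_poly_mult:
  fixes g :: "'a::field mpoly"
  assumes "p > 0" "i < length a"
  shows "qderiv p i (qf_poly p a * g) = mconst (a ! i) * g + qf_poly p a * qderiv p i g"
proof -
  have "(\<Sum>k<length a. if k = i then mconst (a ! k) * g else 0) = mconst (a ! i) * g"
    using assms(2) by (simp add: sum.delta)
  then show ?thesis using assms(1)
    by (simp add: qf_poly_def sum_distrib_right qderiv_sum qderiv_var_power_mult sum.distrib)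
qed

lemma qderiv_qf_poly_power_mult:
  fixes g :: "'a::field mpoly"
  assumes "p > 0" "i < length a"
  shows "qderiv p i (qf_poly p a ^ Suc k * g) =
    qf_poly p a ^ k * (mconst (of_nat (Suc k) * a ! i) * g + qf_poly p a * qderiv p i g)"
proof (induction k)
  case 0
  then show ?case using qderiv_qf_poly_mult[OF assms] by simp
next
  case (Suc k)
  have "qf_poly p a ^ Suc (Suc k) * g = qf_poly p a * (qf_poly p a ^ Suc k * g)"
    by (simp add: mult.assoc)
  then have "qderiv p i (qf_poly p a ^ Suc (Suc k) * g) = mconst (a ! i) * (qf_poly p a ^ Suc k * g)
    + qf_poly p a * (qf_poly p a ^ k * (mconst (of_nat (Suc k) * a ! i) * g + qf_poly p a * qderiv p i g))"
    by (simp only: qderiv_qf_poly_mult[OF assms] Suc)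
  moreover have "mconst (of_nat (Suc (Suc k)) * a ! i) = mconst (a ! i) + mconst (of_nat (Suc k) * a ! i)"
    by (simp add: algebra_simps flip: single_add)
  ultimately show ?case by (simp add: algebra_simps del: of_nat_Suc)
qed

subsection \<open>The Frobenius on polynomials\<close>

lemma single_power:
  "Poly_Mapping.single m c ^ n = Poly_Mapping.single (Poly_Mapping.map ((*) n) m) (c ^ n :: 'a::comm_semiring_1)"
  for m :: "'i \<Rightarrow>\<^sub>0 nat"
proof (induction n)
  case 0
  have "Poly_Mapping.map ((*) 0) m = 0"
    by (rule poly_mapping_eqI) (simp add: map.rep_eq when_def)
  then show ?case by (simp only: power_0 single_one)
next
  case (Suc n)
  have "m + Poly_Mapping.map ((*) n) m = Poly_Mapping.map ((*) (Suc n)) m"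
    by (rule poly_mapping_eqI) (simp add: map.rep_eq when_def lookup_add)
  then show ?case by (simp only: power_Suc Suc mult_single)
qed

lemma lookup_map_mult: "Poly_Mapping.lookup (Poly_Mapping.map ((*) n) m) i = n * Poly_Mapping.lookup m i"
  for m :: "'i \<Rightarrow>\<^sub>0 nat"
  by (simp add: map.rep_eq when_def)

lemma CHAR_mpoly: "CHAR('a::comm_ring_1 mpoly) = CHAR('a)"
proof -
  have "mconst c = 0 \<longleftrightarrow> c = 0" for c :: 'a
    by (metis single_zero lookup_single_eq lookup_zero)
  then have "of_nat n = (0 :: 'a mpoly) \<longleftrightarrow> of_nat n = (0 :: 'a)" for n
    by (simp only: single_of_nat[symmetric])
  then show ?thesis by (intro CHAR_eqI) (auto simp: of_nat_eq_0_iff_char_dvd)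
qed

context char_p_field
begin

lemma frob_mpoly_add: "(f + g :: 'k mpoly) ^ p = f ^ p + g ^ p"
  using prime_p char_p by (intro freshmans_dream) (auto simp: CHAR_mpoly)

lemma frob_mpoly_sum: "(sum f A :: 'k mpoly) ^ p = (\<Sum>i\<in>A. f i ^ p)"
  using prime_p char_p by (intro freshmans_dream_sum) (auto simp: CHAR_mpoly)

lemma frob_of_nat: "(of_nat n :: 'k) ^ p = of_nat n"
  using p_pos by (induction n) (auto simp: frob_add power_0_left)

text \<open>On p-th powers \<open>div p\<close> undoes the scaling of the exponents, and the integer
  factors are fixed by the Frobenius.\<close>

lemma qderiv_power_p: "qderiv p i (f ^ p :: 'k mpoly) = qderiv 1 i f ^ p"
proof (induction f rule: mpoly_induct)
  case (single m c)
  have "Poly_Mapping.map ((*) p) m - Poly_Mapping.single i p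
    = Poly_Mapping.map ((*) p) (m - Poly_Mapping.single i 1)"
    by (rule poly_mapping_eqI)
      (auto simp: lookup_map_mult lookup_minus lookup_single when_def diff_mult_distrib2)
  then show ?case using p_pos
    by (simp add: single_power qderiv_single lookup_map_mult power_mult_distrib frob_of_nat)
qed (simp add: frob_mpoly_add qderiv_add)

lemma lookup_power_p:
  "Poly_Mapping.lookup (f ^ p :: 'k mpoly) (Poly_Mapping.map ((*) p) m) = Poly_Mapping.lookup f m ^ p"
proof (induction f rule: mpoly_induct)
  case (single n c)
  have "Poly_Mapping.map ((*) p) n = Poly_Mapping.map ((*) p) m \<longleftrightarrow> n = m"
    using p_pos by (auto simp: poly_mapping_eq_iff fun_eq_iff lookup_map_mult)
  then show ?case using p_pos by (simp add: single_power lookup_single when_def power_0_left)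
qed (simp add: frob_mpoly_add lookup_add frob_add)

text \<open>The coefficients of \<open>f ^ p\<close> are p-th powers, hence scalars for
  \<open>l\<close>; so applying \<open>l\<close> to coefficients is linear over p-th powers of
  polynomials.\<close>

lemma map_frob_mult:
  fixes f g :: "'k mpoly" and l :: "'k \<Rightarrow> 'k"
  assumes l: "\<And>x y. l (x + y) = l x + l y" "\<And>c x. l (c ^ p * x) = c ^ p * l x"
  shows "Poly_Mapping.map l (f ^ p * g) = f ^ p * Poly_Mapping.map l g"
proof -
  have l0: "l 0 = 0" by (metis l(1) add.right_neutral add_cancel_left_right)
  have map_add: "Poly_Mapping.map l (u + v) = Poly_Mapping.map l u + Poly_Mapping.map l v" for u v :: "'k mpoly"
    by (rule poly_mapping_eqI) (auto simp: map.rep_eq when_def lookup_add l0 simp flip: l(1))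
  show ?thesis
  proof (induction f rule: mpoly_induct)
    case (single m c)
    show ?case
    proof (induction g rule: mpoly_induct)
      case (single n d)
      have "Poly_Mapping.map l (Poly_Mapping.single k x) = Poly_Mapping.single k (l x)" for k :: "nat \<Rightarrow>\<^sub>0 nat" and x
        by (rule poly_mapping_eqI) (auto simp: map.rep_eq when_def lookup_single l0)
      then show ?case by (simp add: single_power mult_single l(2))
    qed (simp add: distrib_left map_add)
  qed (simp add: frob_mpoly_add distrib_right map_add)
qed

text \<open>The form extended to the polynomial ring; when it is a multiple of
  \<open>qf_poly p a\<close>, evaluation at the generic point yields an isotropic vector.\<close>

definition form_poly :: "'k list \<Rightarrow> (nat \<Rightarrow> 'k mpoly) \<Rightarrow> 'k mpoly" where
  "form_poly a f = (\<Sum>j<length a. mconst (a ! j) * f j ^ p)"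

lemma qderiv_form_poly: "qderiv p i (form_poly a f) = form_poly a (\<lambda>j. qderiv 1 i (f j))"
  by (simp add: form_poly_def qderiv_sum qderiv_const_mult qderiv_power_p)

lemma homog_form_poly:
  "(\<And>j. j < length a \<Longrightarrow> homog I d (f j)) \<Longrightarrow> homog I (p * d) (form_poly a f)"
  unfolding form_poly_def by (intro homog_sum homog_const_mult homog_power) auto

text \<open>Anisotropy persists over the polynomial ring: the coefficient at each exponent
  \<open>p * m\<close> is a value of the form over the base field.\<close>

lemma form_poly_eq_0:
  assumes a: "qf_anisotropic p a" and f: "form_poly a f = 0" and j: "j < length a"
  shows "f j = 0"
proof (rule poly_mapping_eqI)
  fix m
  have "0 = Poly_Mapping.lookup (form_poly a f) (Poly_Mapping.map ((*) p) m)" by (simp add: f)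
  also have "\<dots> = qf_val p a (\<lambda>j. Poly_Mapping.lookup (f j) m)"
    by (simp add: form_poly_def qf_val_def lookup_sum lookup_power_p lookup_const_mult)
  finally show "Poly_Mapping.lookup (f j) m = Poly_Mapping.lookup 0 m"
    using a j by (auto simp: qf_anisotropic_def)
qed

end

section \<open>Function fields of quasilinear hypersurfaces\<close>

context char_p_field
begin

lemma aniso_distinct: assumes "qf_anisotropic p (xs::'k list)" shows "distinct xs"
proof -
  have "length xs \<le> length (remdups xs)"
    by (rule steinitz[OF assms]) (auto intro: V_mem)
  then have "length (remdups xs) = length xs" using length_remdups_leq[of xs] by simp
  then show ?thesis by (simp only: length_remdups_eq remdups_id_iff_distinct)
qed

lemma aniso_nonzero: assumes "qf_anisotropic p (xs::'k list)" "i < length xs" shows "xs ! i \<noteq> 0"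
proof
  assume "xs ! i = 0"
  then have "qf_val p xs (\<lambda>j. if j = i then 1 else 0) = 0"
    using p_pos by (auto simp: qf_val_def power_0_left intro!: sum.neutral)
  then have "(if i = i then 1 else 0) = (0::'k)"
    using assms unfolding qf_anisotropic_def by blast
  then show False by simp
qed

lemma dual_functional:
  assumes "qf_anisotropic p (xs::'k list)" "j < length xs"
  shows "\<exists>l :: 'k \<Rightarrow> 'k. (\<forall>x y. l (x + y) = l x + l y) \<and> (\<forall>c x. l (c ^ p * x) = c ^ p * l x) \<and>
    (\<forall>i<length xs. l (xs ! i) = (if i = j then 1 else 0))"
proof -
  \<comment> \<open>The field becomes a vector space over itself through the Frobenius, which turns
    anisotropy into ordinary linear independence.\<close>
  let ?s = "\<lambda>(c::'k) x. c ^ p * x"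
  interpret vs: vector_space ?s
    by unfold_locales (auto simp: frob_add algebra_simps)
  interpret vp: vector_space_pair ?s ?s by unfold_locales
  have dist: "distinct xs" by (rule aniso_distinct[OF assms(1)])
  have "vs.independent (set xs)"
  proof (rule vs.independent_if_scalars_zero)
    fix f x assume f: "(\<Sum>x\<in>set xs. f x ^ p * x) = 0" and x: "x \<in> set xs"
    have "(\<Sum>x\<in>set xs. f x ^ p * x) = (\<Sum>i<length xs. f (xs ! i) ^ p * xs ! i)"
      using sum.reindex_bij_betw[OF bij_betw_nth[OF dist refl refl], of "\<lambda>x. f x ^ p * x"] by simp
    then have "qf_val p xs (\<lambda>i. f (xs ! i)) = 0" using f by (simp add: qf_val_def mult.commute)
    then show "f x = 0" using assms(1) x by (auto simp: qf_anisotropic_def in_set_conv_nth)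
  qed simp
  from vp.linear_independent_extend[OF this, of "\<lambda>x. if x = xs ! j then 1 else 0"]
  obtain l where l: "Vector_Spaces.linear ?s ?s l" "\<forall>x\<in>set xs. l x = (if x = xs ! j then 1 else 0)"
    by blast
  interpret l: Vector_Spaces.linear ?s ?s l by (rule l(1))
  show ?thesis using l.add l.scale l(2) dist assms(2)
    by (intro exI[of _ l]) (auto simp: nth_eq_iff_index_eq)
qed

end

section \<open>The function field and its generic point\<close>

locale function_field =
  fixes p :: nat and a :: "'a::field list" and \<sigma> :: "'a \<Rightarrow> 'b::field" and \<xi> :: "nat \<Rightarrow> 'b"
  assumes p_prime: "prime p" and char_base: "CHAR('a) = p"
    and aniso: "qf_anisotropic p a" and dim2: "length a \<ge> 2"
    and ff: "is_function_field p a \<sigma> \<xi>"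
begin

lemma hom: "is_field_hom \<sigma>" using ff by (simp add: is_function_field_def)

lemmas \<sigma>_simps = field_homD[OF hom]

sublocale F: char_p_field p "TYPE('a)"
  by unfold_locales (fact p_prime char_base)+

sublocale L: char_p_field p "TYPE('b)"
  by unfold_locales (use p_prime char_base field_hom_CHAR[OF hom] in auto)

abbreviation ev :: "'a mpoly \<Rightarrow> 'b" where "ev \<equiv> mpoly_eval \<sigma> \<xi>"
abbreviation n :: nat where "n \<equiv> length a"
abbreviation \<phi> :: "'a mpoly" where "\<phi> \<equiv> qf_poly p a"
abbreviation W :: "'b set" where "W \<equiv> qf_values p (map \<sigma> a)"

lemmas ev_simps = mpoly_eval_add[OF hom] mpoly_eval_mult[OF hom] mpoly_eval_power[OF hom]
  mpoly_eval_const[OF hom] mpoly_eval_sum[OF hom] mpoly_eval_zero[OF hom] mpoly_eval_one[OF hom]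

lemma ev_eq_0_iff: "homog {..<n} d f \<Longrightarrow> ev f = 0 \<longleftrightarrow> \<phi> dvd f"
  using ff homog_imp_mpoly[of "{..<n}" d f n] by (simp add: is_function_field_def)

lemma ev_\<phi>: "ev \<phi> = 0"
  using ev_eq_0_iff[OF homog_qf_poly] by simp

lemma ev_form_poly: "ev (F.form_poly c f) = qf_val p (map \<sigma> c) (\<lambda>j. ev (f j))"
  by (simp add: F.form_poly_def qf_val_def ev_simps)

text \<open>A nonzero multiple of \<open>\<phi>\<close> involves the first variable, so the other
  coordinates of \<open>\<xi>\<close> satisfy no homogeneous relation.\<close>

lemma ev_without_first_var:
  assumes f: "homog {1..<n} d f" and 0: "ev f = 0" shows "f = 0"
proof -
  obtain g where g: "f = \<phi> * g"
    using ev_eq_0_iff[of d f] homog_mono[OF f, of "{..<n}"] 0 by (fastforce elim: dvdE)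
  have "g = 0"
  proof (rule qf_poly_mult_without_first_var[of a p])
    show "a \<noteq> []" using dim2 by auto
    then show "a ! 0 \<noteq> 0" using F.aniso_nonzero[OF aniso] by simp
    fix m assume "m \<in> Poly_Mapping.keys (\<phi> * g)"
    then have "0 \<notin> Poly_Mapping.keys m" using f unfolding g[symmetric] homog_def by force
    then show "Poly_Mapping.lookup m 0 = 0" by (simp add: in_keys_iff)
  qed (rule F.p_pos)
  then show ?thesis using g by simp
qed

lemma \<xi>1_nonzero: "\<xi> 1 \<noteq> 0"
proof
  assume 0: "\<xi> 1 = 0"
  define X :: "'a mpoly" where "X = Poly_Mapping.single (Poly_Mapping.single 1 1) 1"
  have "ev X = 0" using mpoly_eval_var[OF hom, of \<xi> 1] 0 by (simp add: X_def)
  moreover have "homog {1..<n} 1 X"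
    unfolding X_def using dim2 by (intro homog_single) (auto simp: mono_degree_single)
  ultimately have "X = 0" using ev_without_first_var by blast
  then show False unfolding X_def by (metis lookup_single_eq lookup_zero zero_neq_one)
qed

subsection \<open>The multiplier field of the values\<close>

definition M :: "'b set" where "M = {x. \<forall>w\<in>W. x * w \<in> W}"

lemma M_intro: assumes "\<And>i. i < n \<Longrightarrow> x * \<sigma> (a ! i) \<in> W" shows "x \<in> M"
proof -
  have "x * w \<in> W" if w: "w \<in> W" for w
  proof -
    have "w \<in> {w. x * w \<in> W}"
    proof (rule L.V_least[OF w])
      show "set (map \<sigma> a) \<subseteq> {w. x * w \<in> W}" using assms by (auto simp: in_set_conv_nth)
      fix c w assume "w \<in> {w. x * w \<in> W}"
      then show "w * c ^ p \<in> {w. x * w \<in> W}" using L.V_scale_right[of "x * w"] by (simp add: mult.assoc)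
    qed (auto simp: distrib_left L.V_zero intro: L.V_add)
    then show ?thesis by simp
  qed
  then show ?thesis by (simp add: M_def)
qed

lemma M_subfield: "subfield_closed M"
proof -
  have mult: "x * y \<in> M" if "x \<in> M" "y \<in> M" for x y using that by (auto simp: M_def mult.assoc)
  have frob: "c ^ p \<in> M" for c by (auto simp: M_def L.V_scale)
  have pow: "x ^ k \<in> M" if "x \<in> M" for x k
    by (induction k) (use that mult in \<open>auto simp: M_def\<close>)
  have "inverse x \<in> M" if "x \<in> M" for x
    using that L.inverse_via_frob[of x] mult[OF pow[OF that] frob] by (cases "x = 0") (simp, metis)
  then show ?thesis using mult
    by (auto simp: subfield_closed_def M_def distrib_right L.V_zero intro: L.V_add L.V_minus)
qed

text \<open>Since \<open>\<phi>\<close> vanishes at \<open>\<xi>\<close>, differentiating the identity \<open>k\<close> times leaves only the terms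
  in which each derivative hits a different factor \<open>\<phi>\<close>.\<close>
lemma derivative_values:
  assumes "F.form_poly a f = \<phi> ^ length is * g" "set is \<subseteq> {..<n}" "length is < p"
  shows "(\<Prod>i\<leftarrow>is. \<sigma> (a ! i)) * ev g \<in> W"
  using assms
proof (induction "is" arbitrary: f g)
  case Nil
  then have "ev g = qf_val p (map \<sigma> a) (\<lambda>j. ev (f j))" using ev_form_poly[of a f] by simp
  then show ?case by (simp add: L.V_val)
next
  case (Cons i "is")
  let ?k = "Suc (length is)"
  let ?g = "mconst (of_nat ?k * a ! i) * g + \<phi> * qderiv p i g"
  have i: "i < n" using Cons.prems by auto
  have "F.form_poly a (\<lambda>j. qderiv 1 i (f j)) = \<phi> ^ length is * ?g"
    using Cons.prems(1) qderiv_qf_poly_power_mult[OF F.p_pos i, of "length is" g]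
    unfolding F.qderiv_form_poly[symmetric] by (simp del: of_nat_Suc)
  then have IH: "(\<Prod>i\<leftarrow>is. \<sigma> (a ! i)) * ev ?g \<in> W"
    using Cons.prems by (intro Cons.IH) auto
  have "\<sigma> (of_nat m) = of_nat m" for m by (induction m) (auto simp: \<sigma>_simps)
  then have "ev ?g = of_nat ?k * (\<sigma> (a ! i) * ev g)"
    by (simp add: ev_simps \<sigma>_simps ev_\<phi> del: of_nat_Suc)
  \<comment> \<open>Natural numbers are their own p-th powers, so the factor \<open>?k\<close> from
    the product rule is a scalar for \<open>W\<close>; it is invertible because
    \<open>?k < p\<close>.\<close>
  then have "of_nat ?k ^ p * ((\<Prod>i\<leftarrow>i # is. \<sigma> (a ! i)) * ev g) \<in> W"
    using IH by (simp add: L.frob_of_nat ac_simps del: of_nat_Suc)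
  then have "inverse (of_nat ?k) ^ p * (of_nat ?k ^ p * ((\<Prod>i\<leftarrow>i # is. \<sigma> (a ! i)) * ev g)) \<in> W"
    by (rule L.V_scale)
  moreover have "of_nat ?k \<noteq> (0::'b)"
    using Cons.prems(3) L.char_p by (auto simp: of_nat_eq_0_iff_char_dvd simp del: of_nat_Suc dest: dvd_imp_le)
  ultimately show ?case by (simp add: power_inverse mult.assoc[symmetric] del: of_nat_Suc)
qed

lemma multiplier_of_relation:
  assumes "F.form_poly a f = \<phi> * g" shows "ev g \<in> M"
proof (rule M_intro)
  fix i assume "i < n"
  then show "ev g * \<sigma> (a ! i) \<in> W"
    using derivative_values[of f "[i]" g] assms prime_gt_1_nat[OF p_prime] by (simp add: mult.commute)
qed

text \<open>A functional dual to \<open>a ! j\<close>, applied to all coefficients, isolates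
  \<open>f j ^ p\<close> and keeps the factor \<open>\<phi> ^ p\<close>, which vanishes at
  \<open>\<xi>\<close>.\<close>

lemma p_th_power_of_form:
  assumes "F.form_poly a f = \<phi> ^ p * g" "j < n" shows "ev (f j) = 0"
proof -
  obtain l where l: "\<And>x y. l (x + y) = l x + l y" "\<And>c x. l (c ^ p * x) = c ^ p * l x"
    and dual: "\<And>i. i < n \<Longrightarrow> l (a ! i) = (if i = j then 1 else 0)"
    using F.dual_functional[OF aniso assms(2)] by blast
  let ?l = "Poly_Mapping.map l :: 'a mpoly \<Rightarrow> 'a mpoly"
  have l0: "l 0 = 0" by (metis l(1) add.right_neutral add_cancel_left_right)
  have add: "?l (u + v) = ?l u + ?l v" for u v
    by (rule poly_mapping_eqI) (auto simp: map.rep_eq when_def lookup_add l0 simp flip: l(1))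
  have sum: "?l (sum h A) = (\<Sum>i\<in>A. ?l (h i))" for h :: "nat \<Rightarrow> 'a mpoly" and A
    by (induction A rule: infinite_finite_induct) (auto simp: add map_eq_zero_iff)
  have const: "?l (mconst c) = mconst (l c)" for c
    by (rule poly_mapping_eqI) (auto simp: map.rep_eq when_def lookup_single l0)
  have "?l (mconst (a ! i) * f i ^ p) = (if i = j then f j ^ p else 0)" if "i < n" for i
    using F.map_frob_mult[of l "f i" "mconst (a ! i)", OF l] dual[OF that]
    by (simp add: const mult.commute)
  then have "?l (F.form_poly a f) = (\<Sum>i<n. if i = j then f j ^ p else 0)"
    unfolding F.form_poly_def sum by (intro sum.cong) auto
  also have "\<dots> = f j ^ p" using assms(2) by (simp add: sum.delta)
  finally have "f j ^ p = \<phi> ^ p * ?l g" using F.map_frob_mult[of l \<phi> g, OF l] assms(1) by simp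
  then have "ev (f j) ^ p = ev \<phi> ^ p * ev (?l g)" by (metis ev_simps(2,3))
  then show ?thesis using F.p_pos by (simp add: ev_\<phi> power_0_left)
qed

text \<open>Take the largest power \<open>\<phi> ^ k\<close> dividing the form: \<open>k < p\<close>
  by \<open>p_th_power_of_form\<close>, and by maximality the cofactor is nonzero at
  \<open>\<xi>\<close>.\<close>

lemma double_relation:
  assumes f: "\<And>j. j < n \<Longrightarrow> homog {..<n} d (f j)" and eq: "F.form_poly a f = \<phi>\<^sup>2 * g"
    and j: "j < n" "ev (f j) \<noteq> 0"
  shows "\<exists>w. w \<noteq> 0 \<and> (\<forall>i<n. w * \<sigma> (a ! i) \<in> M)"
proof -
  let ?P = "\<lambda>k. \<phi> ^ k dvd F.form_poly a f"
  have bound: "k < p" if "?P k" for k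
  proof (rule ccontr)
    assume "\<not> k < p"
    then have "\<phi> ^ p dvd F.form_poly a f" using that dvd_trans le_imp_power_dvd by (metis not_less)
    then show False using p_th_power_of_form j by (auto simp: dvd_def)
  qed
  have P2: "?P 2" using eq by simp
  define k where "k = (GREATEST k. ?P k)"
  have k: "?P k" "2 \<le> k"
    unfolding k_def using GreatestI_nat[of ?P 2 p, OF P2] Greatest_le_nat[of ?P 2 p, OF P2] bound
    by (simp_all add: less_imp_le)
  have kmax: "\<not> ?P (Suc k)"
    using Greatest_le_nat[of ?P "Suc k" p] bound unfolding k_def[symmetric] by (meson less_imp_le not_less_eq_eq order_refl)
  from k(1) obtain h where "F.form_poly a f = \<phi> ^ k * h" by (auto simp: dvd_def)
  then obtain h where h: "homog {..<n} (p * d - k * p) h" "F.form_poly a f = \<phi> ^ k * h"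
    using homog_quotient[OF F.homog_form_poly[of a "{..<n}" d f]] f by blast
  have "ev h \<noteq> 0"
  proof
    assume "ev h = 0"
    then have "\<phi> dvd h" using ev_eq_0_iff[OF h(1)] by simp
    then have "?P (Suc k)" unfolding h(2) power_Suc2 by (intro mult_dvd_mono) auto
    then show False using kmax by simp
  qed
  have a0: "\<sigma> (a ! 0) \<noteq> 0" using F.aniso_nonzero[OF aniso, of 0] dim2 by (cases a) (auto simp: \<sigma>_simps)
  let ?w = "\<sigma> (a ! 0) ^ (k - 2) * ev h"
  have "?w * \<sigma> (a ! i) * \<sigma> (a ! m) \<in> W" if "i < n" "m < n" for i m
  proof -
    \<comment> \<open>Differentiating \<open>k - 2\<close> times in variable \<open>0\<close> and
      once each in \<open>i\<close> and \<open>m\<close> uses up all \<open>k\<close> factors and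
      leaves a multiplier \<open>?w\<close> that depends on neither \<open>i\<close> nor
      \<open>m\<close>.\<close>
    have len: "length (replicate (k - 2) 0 @ [i, m]) = k" using k by simp
    have "(\<Prod>i\<leftarrow>replicate (k - 2) 0 @ [i, m]. \<sigma> (a ! i)) * ev h \<in> W"
      using that dim2 h(2) bound[OF k(1)]
      by (intro derivative_values[of f]) (use len in \<open>auto simp del: length_append\<close>)
    then show ?thesis by (simp add: prod_list_replicate ac_simps)
  qed
  then have "?w * \<sigma> (a ! i) \<in> M" if "i < n" for i using that by (intro M_intro) auto
  moreover have "?w \<noteq> 0" using \<open>ev h \<noteq> 0\<close> a0 by simp
  ultimately show ?thesis by blast
qed

subsection \<open>Fractions in a subset of the homogeneous coordinates\<close>

text \<open>For all indices this is the whole function field; without index \<open>0\<close> it is a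
  rational function field over the base.\<close>

definition Fr :: "nat set \<Rightarrow> 'b set" where
  "Fr I = {ev u / ev v | u v d. homog I d u \<and> homog I d v \<and> ev v \<noteq> 0}"

lemma FrI: "homog I d u \<Longrightarrow> homog I d v \<Longrightarrow> ev v \<noteq> 0 \<Longrightarrow> ev u / ev v \<in> Fr I"
  unfolding Fr_def by blast

lemma Fr_const: "\<sigma> c \<in> Fr I"
  using FrI[OF homog_const[of I c] homog_const[of I 1]] by (simp add: ev_simps \<sigma>_simps)

lemma homog_var: "i \<in> I \<Longrightarrow> homog I 1 (Poly_Mapping.single (Poly_Mapping.single i 1) (1::'a))"
  by (intro homog_single) (auto simp: mono_degree_single)

lemma Fr_ratio: "i \<in> I \<Longrightarrow> j \<in> I \<Longrightarrow> \<xi> j \<noteq> 0 \<Longrightarrow> \<xi> i / \<xi> j \<in> Fr I"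
  using FrI[OF homog_var homog_var, of i I j] mpoly_eval_var[OF hom, of \<xi>] by simp

lemma Fr_subfield: "subfield_closed (Fr I)"
  unfolding subfield_closed_def
proof (intro conjI ballI)
  show "0 \<in> Fr I" "1 \<in> Fr I" using Fr_const[of 0] Fr_const[of 1] by (simp_all add: \<sigma>_simps)
next
  fix x y assume "x \<in> Fr I" "y \<in> Fr I"
  then obtain u v d u' v' d' where x: "homog I d u" "homog I d v" "ev v \<noteq> 0" "x = ev u / ev v"
    and y: "homog I d' u'" "homog I d' v'" "ev v' \<noteq> 0" "y = ev u' / ev v'"
    unfolding Fr_def by blast
  have "homog I (d + d') (v * v')" using x y by (intro homog_mult)
  moreover have "homog I (d + d') (u * u')" "homog I (d + d') (u * v' + v * u')"
    using x y by (auto intro!: homog_mult homog_add)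
  moreover have "ev (v * v') \<noteq> 0" using x y by (simp add: ev_simps)
  moreover have "x * y = ev (u * u') / ev (v * v')" "x + y = ev (u * v' + v * u') / ev (v * v')"
    unfolding x(4) y(4) ev_simps using x y by (simp_all add: add_frac_eq mult.commute)
  ultimately show "x + y \<in> Fr I" "x * y \<in> Fr I" by (metis FrI)+
next
  fix x assume "x \<in> Fr I"
  then obtain u v d where x: "homog I d u" "homog I d v" "ev v \<noteq> 0" "x = ev u / ev v"
    unfolding Fr_def by blast
  have "\<sigma> (- 1) = - 1" using \<sigma>_simps(2)[of "-1" 1] by (simp add: \<sigma>_simps eq_neg_iff_add_eq_0)
  then have "ev (mconst (- 1) * u) + ev u = 0" by (simp add: ev_simps)
  then have "- x = ev (mconst (- 1) * u) / ev v" using x by (simp add: field_simps add_eq_0_iff)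
  then show "- x \<in> Fr I" using FrI[OF homog_const_mult[OF x(1)] x(2,3), of "-1"] by simp
  show "inverse x \<in> Fr I"
  proof (cases "ev u = 0")
    case True
    then show ?thesis using x(4) \<open>x \<in> Fr I\<close> by simp
  next
    case False
    then show ?thesis using FrI[OF x(2,1)] x(4) by simp
  qed
qed

lemma Fr_all: "x \<in> Fr {..<n}"
proof -
  have "Fr {..<n} = UNIV"
    using ff Fr_subfield[of "{..<n}"] Fr_const Fr_ratio[of _ "{..<n}"]
    unfolding is_function_field_def by (metis image_subsetI lessThan_iff)
  then show ?thesis by simp
qed

lemma common_denominator:
  fixes N :: nat
  assumes "\<And>l. l < N \<Longrightarrow> x l \<in> Fr I"
  shows "\<exists>v d u. homog I d v \<and> ev v \<noteq> 0 \<and> (\<forall>l<N. homog I d (u l) \<and> x l = ev (u l) / ev v)"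
  using assms
proof (induction N)
  case 0
  show ?case using homog_const[of I "1::'a"]
    by (intro exI[of _ "mconst 1"] exI[of _ "0::nat"] exI[of _ "\<lambda>_. 0"]) (simp add: ev_simps)
next
  case (Suc N)
  then obtain v d u where v: "homog I d v" "ev v \<noteq> 0"
    and u: "\<And>l. l < N \<Longrightarrow> homog I d (u l) \<and> x l = ev (u l) / ev v" by (metis less_Suc_eq)
  obtain u' v' d' where x: "homog I d' u'" "homog I d' v'" "ev v' \<noteq> 0" "x N = ev u' / ev v'"
    using Suc.prems[of N] unfolding Fr_def by auto
  let ?u = "\<lambda>l. if l = N then v * u' else u l * v'"
  have "homog I (d + d') (?u l) \<and> x l = ev (?u l) / ev (v * v')" if "l < Suc N" for l
    using u[of l] x v that by (auto simp: ev_simps less_Suc_eq intro!: homog_mult)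
  moreover have "homog I (d + d') (v * v')" "ev (v * v') \<noteq> 0"
    using v x by (auto intro: homog_mult simp: ev_simps)
  ultimately show ?case
    by (intro exI[of _ "v * v'"] exI[of _ "d + d'"] exI[of _ ?u] conjI allI impI) simp_all
qed

abbreviation K :: "'b set" where "K \<equiv> Fr {1..<n}"

text \<open>Clearing denominators turns an isotropic vector over \<open>K\<close> into a polynomial
  relation, which \<open>form_poly_eq_0\<close> excludes.\<close>

lemma aniso_over_K:
  assumes c: "qf_anisotropic p c" and x: "\<And>l. l < length c \<Longrightarrow> x l \<in> K"
    and 0: "qf_val p (map \<sigma> c) x = 0" and l: "l < length c"
  shows "x l = 0"
proof -
  obtain v d u where v: "homog {1..<n} d v" "ev v \<noteq> 0"
    and u: "\<And>l. l < length c \<Longrightarrow> homog {1..<n} d (u l) \<and> x l = ev (u l) / ev v"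
    using common_denominator[of "length c" x "{1..<n}"] x by blast
  have "ev (F.form_poly c u) = qf_val p (map \<sigma> c) (\<lambda>l. ev v * x l)"
    unfolding ev_form_poly using u v by (intro qf_val_cong) auto
  also have "\<dots> = 0" by (simp add: 0 flip: L.qf_val_scale)
  finally have "F.form_poly c u = 0"
    using ev_without_first_var[OF F.homog_form_poly[of c "{1..<n}" d u]] u by blast
  then show ?thesis using F.form_poly_eq_0[OF c _ l, of u] u[OF l] by (simp add: ev_simps)
qed

subsection \<open>The function field as a purely inseparable extension of degree p\<close>

definition \<theta> :: 'b where "\<theta> = \<xi> 0 / \<xi> 1"

lemma \<xi>_isotropic: "qf_val p (map \<sigma> a) \<xi> = 0"
  using ev_\<phi> F.p_pos
  by (simp add: qf_poly_def qf_val_def mpoly_eval_sum[OF hom] mpoly_eval_single[OF hom] mono_eval_def)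

text \<open>Divide the equation of the generic zero by \<open>\<xi> 1 ^ p\<close> and solve it for
  its first term.\<close>

lemma \<theta>_power_p: "\<theta> ^ p \<in> K"
proof -
  obtain a0 as where a: "a = a0 # as" using dim2 by (cases a) auto
  have a0: "a0 \<noteq> 0" using F.aniso_nonzero[OF aniso, of 0] a by simp
  have "qf_val p (map \<sigma> a) (\<lambda>i. inverse (\<xi> 1) * \<xi> i) = 0"
    by (simp add: \<xi>_isotropic flip: L.qf_val_scale)
  then have "qf_val p ([\<sigma> a0] @ map \<sigma> as) (\<lambda>i. \<xi> i / \<xi> 1) = 0" using a by (simp add: field_simps)
  then have "\<sigma> a0 * \<theta> ^ p = - qf_val p (map \<sigma> as) (\<lambda>i. \<xi> (Suc i) / \<xi> 1)"
    unfolding qf_val_append by (simp add: qf_val_def \<theta>_def eq_neg_iff_add_eq_0)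
  then have "\<theta> ^ p = - qf_val p (map \<sigma> as) (\<lambda>i. \<xi> (Suc i) / \<xi> 1) / \<sigma> a0"
    using a0 by (simp add: \<sigma>_simps field_simps)
  also have "\<dots> \<in> K"
  proof (intro subfield_closedD(5,8)[OF Fr_subfield] Fr_const)
    show "qf_val p (map \<sigma> as) (\<lambda>i. \<xi> (Suc i) / \<xi> 1) \<in> K"
      unfolding qf_val_def using a dim2 \<xi>1_nonzero
      by (intro subfield_closed_sum[OF Fr_subfield] subfield_closedD(4)[OF Fr_subfield]
          subfield_closed_power[OF Fr_subfield] Fr_ratio) (auto intro: Fr_const)
  qed
  finally show ?thesis .
qed

text \<open>The combinations form a ring containing \<open>K\<close> and \<open>\<theta>\<close>.
  The p-th power of each of them lies in \<open>K\<close>, which gives inverses, so the ring is the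
  field generated by the coordinate ratios.\<close>

lemma K_\<theta>_basis: "\<exists>\<kappa>. (\<forall>j. \<kappa> j \<in> K) \<and> x = (\<Sum>j<p. \<kappa> j * \<theta> ^ j)"
proof -
  define R where "R = {x. \<exists>\<kappa>. (\<forall>j. \<kappa> j \<in> K) \<and> x = (\<Sum>j<p. \<kappa> j * \<theta> ^ j)}"
  note K = subfield_closedD[OF Fr_subfield[of "{1..<n}"]]
  have R_mono: "k * \<theta> ^ m \<in> R" if k: "k \<in> K" for k m
  proof -
    let ?c = "k * (\<theta> ^ p) ^ (m div p)"
    have "?c \<in> K" by (rule K(4)[OF k subfield_closed_power[OF Fr_subfield \<theta>_power_p]])
    moreover have "k * \<theta> ^ m = ?c * \<theta> ^ (m mod p)"
      by (simp add: mult.assoc flip: power_mult power_add)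
    moreover have "(\<Sum>j<p. (if j = m mod p then ?c else 0) * \<theta> ^ j) =
      (\<Sum>j<p. if j = m mod p then ?c * \<theta> ^ (m mod p) else 0)"
      by (intro sum.cong) auto
    ultimately show ?thesis unfolding R_def using F.p_pos K(1)
      by (auto simp: sum.delta intro!: exI[of _ "\<lambda>j. if j = m mod p then ?c else 0"])
  qed
  have K_R: "k \<in> R" if "k \<in> K" for k using R_mono[OF that, of 0] by simp
  have R_add: "x + y \<in> R" if xy: "x \<in> R" "y \<in> R" for x y
  proof -
    obtain k l where "\<forall>j. k j \<in> K" "\<forall>j. l j \<in> K" "x = (\<Sum>j<p. k j * \<theta> ^ j)" "y = (\<Sum>j<p. l j * \<theta> ^ j)"
      using xy unfolding R_def by auto
    then show ?thesis unfolding R_def using K(3)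
      by (intro CollectI exI[of _ "\<lambda>j. k j + l j"]) (simp add: sum.distrib distrib_right)
  qed
  have R_sum: "sum f A \<in> R" if "\<And>j. j \<in> A \<Longrightarrow> f j \<in> R" for f :: "nat \<Rightarrow> 'b" and A
    using that by (induction A rule: infinite_finite_induct) (auto intro: R_add K_R K(1))
  have R_mult: "x * y \<in> R" if xy: "x \<in> R" "y \<in> R" for x y
  proof -
    obtain k l where kl: "\<forall>j. k j \<in> K" "\<forall>j. l j \<in> K" "x = (\<Sum>j<p. k j * \<theta> ^ j)" "y = (\<Sum>j<p. l j * \<theta> ^ j)"
      using xy unfolding R_def by auto
    have "x * y = (\<Sum>i<p. \<Sum>j<p. k i * l j * \<theta> ^ (i + j))"
      unfolding kl by (simp add: sum_product power_add ac_simps)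
    also have "\<dots> \<in> R" using kl by (intro R_sum R_mono K(4)) auto
    finally show ?thesis .
  qed
  have R_minus: "- x \<in> R" if "x \<in> R" for x
    using R_mult[OF K_R[OF K(5)[OF K(2)]] that] by simp
  have R_power: "x ^ m \<in> R" if "x \<in> R" for x m
    by (induction m) (use R_mult that K_R[OF K(2)] in auto)
  have R_inverse: "inverse x \<in> R" if x: "x \<in> R" for x
  proof (cases "x = 0")
    case False
    obtain k where k: "\<forall>j. k j \<in> K" "x = (\<Sum>j<p. k j * \<theta> ^ j)" using x unfolding R_def by auto
    have "x ^ p = (\<Sum>j<p. k j ^ p * (\<theta> ^ p) ^ j)"
      unfolding k(2) L.frob_sum by (simp add: power_mult_distrib mult.commute flip: power_mult)
    also have "\<dots> \<in> K" using k(1)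
      by (intro subfield_closed_sum[OF Fr_subfield] K(4)
          subfield_closed_power[OF Fr_subfield \<theta>_power_p] subfield_closed_power[OF Fr_subfield]) auto
    finally have "inverse x ^ p \<in> R" by (metis K(6) K_R power_inverse)
    then show ?thesis using L.inverse_via_frob[OF False] R_mult R_power[OF x] by metis
  qed (use K_R K(1) in simp)
  have R: "subfield_closed R"
    unfolding subfield_closed_def using K_R[OF K(1)] K_R[OF K(2)]
    by (intro conjI ballI R_add R_mult R_minus R_inverse) assumption+
  have R1: "\<xi> i / \<xi> 1 \<in> R" if "i < n" for i
  proof (cases "i = 0")
    case True
    then show ?thesis using R_mono[OF K(2), of 1] by (simp add: \<theta>_def)
  next
    case False
    then show ?thesis using that dim2 \<xi>1_nonzero by (intro K_R Fr_ratio) auto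
  qed
  have "\<xi> i / \<xi> j \<in> R" if "i < n" "j < n" for i j
  proof -
    have "\<xi> i / \<xi> j = (\<xi> i / \<xi> 1) / (\<xi> j / \<xi> 1)"
      using \<xi>1_nonzero by (simp del: One_nat_def)
    then show ?thesis using subfield_closedD(8)[OF R R1[OF that(1)] R1[OF that(2)]] by metis
  qed
  moreover have "range \<sigma> \<subseteq> R" using K_R Fr_const by blast
  ultimately have "R = UNIV" using ff R unfolding is_function_field_def by simp
  then show ?thesis unfolding R_def by blast
qed

text \<open>Expanding the coordinates along \<open>B\<close> in powers of \<open>\<theta>\<close>
  gives \<open>p * length B\<close> linear equations over \<open>K\<close>. More unknowns than that
  would produce an isotropic vector for \<open>c\<close> over \<open>K\<close>.\<close>

lemma length_le_p_times:
  assumes c: "qf_anisotropic p c" and B: "set (map \<sigma> c) \<subseteq> L.V B"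
  shows "length c \<le> p * length B"
proof (rule ccontr)
  assume *: "\<not> ?thesis"
  have "\<exists>v. map \<sigma> c ! l = qf_val p B v" if "l < length c" for l
  proof -
    have "map \<sigma> c ! l \<in> L.V B" using B that by (intro subsetD[OF B] nth_mem) simp
    then show ?thesis by (auto simp: qf_values_def)
  qed
  then obtain \<rho> where \<rho>: "\<And>l. l < length c \<Longrightarrow> map \<sigma> c ! l = qf_val p B (\<rho> l)" by metis
  obtain \<kappa> where \<kappa>: "\<And>x j. \<kappa> x j \<in> K" "\<And>x. x = (\<Sum>j<p. \<kappa> x j * \<theta> ^ j)"
    using K_\<theta>_basis by metis
  \<comment> \<open>One equation for each pair of an index of \<open>B\<close> and a power of
    \<open>\<theta>\<close>; quotient and remainder of \<open>i\<close> by \<open>p\<close> encode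
    the pair.\<close>
  have "\<exists>x. (\<forall>l. x l \<in> K) \<and> (\<exists>l<length c. x l \<noteq> 0) \<and>
    (\<forall>i<length B * p. (\<Sum>l<length c. \<kappa> (\<rho> l (i div p)) (i mod p) * x l) = 0)"
    using * \<kappa>(1) by (intro homogeneous_system_nontrivial_solution[OF Fr_subfield]) (auto simp: mult.commute)
  then obtain x where x: "\<And>l. x l \<in> K" "\<exists>l<length c. x l \<noteq> 0"
    and sol: "\<And>i. i < length B * p \<Longrightarrow> (\<Sum>l<length c. \<kappa> (\<rho> l (i div p)) (i mod p) * x l) = 0" by blast
  have "(\<Sum>l<length c. \<rho> l b * x l) = 0" if b: "b < length B" for b
  proof -
    have sol': "(\<Sum>l<length c. \<kappa> (\<rho> l b) j * x l) = 0" if j: "j < p" for j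
    proof -
      have "b * p + j < Suc b * p" using j by simp
      also have "\<dots> \<le> length B * p" using b by (intro mult_right_mono) auto
      finally show ?thesis using sol[of "b * p + j"] j by simp
    qed
    have "(\<Sum>l<length c. \<rho> l b * x l) = (\<Sum>l<length c. (\<Sum>j<p. \<kappa> (\<rho> l b) j * \<theta> ^ j) * x l)"
      using \<kappa>(2) by simp
    also have "\<dots> = (\<Sum>j<p. \<theta> ^ j * (\<Sum>l<length c. \<kappa> (\<rho> l b) j * x l))"
      unfolding sum_distrib_right sum_distrib_left by (subst sum.swap) (simp add: ac_simps)
    finally show ?thesis using sol' by simp
  qed
  then have "qf_val p B (\<lambda>b. \<Sum>l<length c. \<rho> l b * x l) = 0"
    using F.p_pos by (simp add: qf_val_def power_0_left)
  then have "qf_val p (map \<sigma> c) x = 0"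
    using L.qf_val_substitute[of "map \<sigma> c" B "\<lambda>b l. \<rho> l b" x] \<rho> by simp
  then have "\<forall>l<length c. x l = 0" using aniso_over_K[of c x] c x(1) by blast
  then show False using x(2) by blast
qed

end

context function_field
begin

lemma M_frob: "c ^ p \<in> M"
  by (auto simp: M_def L.V_scale)

subsection \<open>The neighbour case\<close>

text \<open>The quotients of the \<open>a ! i\<close> by \<open>a ! 0\<close> generate the value
  field of a Pfister form over the base. The image of that form lies in \<open>M\<close>, hence in a
  multiple of \<open>W\<close>, and \<open>length_le_p_times\<close> bounds its dimension.\<close>

lemma scaled_coefficients_in_M_imp_neighbour:
  assumes w: "w \<noteq> 0" "\<And>i. i < n \<Longrightarrow> w * \<sigma> (a ! i) \<in> M"
  shows "qp_neighbour p a"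
proof -
  note M = subfield_closedD[OF M_subfield]
  let ?a0 = "a ! 0"
  have n0: "0 < n" using dim2 by linarith
  have a0: "?a0 \<noteq> 0" using F.aniso_nonzero[OF aniso n0] .
  then have \<sigma>a0: "\<sigma> ?a0 \<noteq> 0" by (simp add: \<sigma>_simps)
  define cs where "cs = map ((*) (inverse ?a0)) a"
  have cs_aniso: "qf_anisotropic p cs" unfolding cs_def using a0 by (intro F.aniso_mult[OF aniso]) simp
  obtain bs where bs: "set bs \<subseteq> set cs" "qf_anisotropic p (qpfister p bs)" "set cs \<subseteq> F.V (qpfister p bs)"
    using F.qpfister_cover by blast
  have "a = qf_scale ?a0 cs" using a0 by (simp add: qf_scale_def cs_def comp_def mult.assoc[symmetric])
  then have "qf_isometric p a (qf_scale ?a0 cs)" using F.aniso_isometric[OF aniso aniso] by simp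
  moreover have "qf_subform p cs (qpfister p bs)"
    using F.aniso_subform[OF cs_aniso F.V_mono[OF bs(3)]] .
  moreover have "length (qpfister p bs) < p * n"
  proof -
    \<comment> \<open>The part of the base field that maps into \<open>M\<close> is a subfield, so
      it contains the Pfister coefficients as soon as it contains the slots.\<close>
    define S where "S = {x. \<sigma> x \<in> M}"
    have minus: "\<sigma> (- x) = - \<sigma> x" for x
      using \<sigma>_simps(2)[of x "- x"] by (simp add: \<sigma>_simps eq_neg_iff_add_eq_0 add.commute)
    have inverse: "\<sigma> (inverse x) = inverse (\<sigma> x)" for x
      using \<sigma>_simps(8)[of 1 x] by (simp add: \<sigma>_simps inverse_eq_divide)
    have "subfield_closed S"
      unfolding subfield_closed_def S_def using M by (auto simp: \<sigma>_simps minus inverse)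
    moreover have "set cs \<subseteq> S"
    proof -
      have "\<sigma> (inverse ?a0 * a ! i) = (w * \<sigma> (a ! i)) / (w * \<sigma> ?a0)" for i
        using w(1) by (simp add: \<sigma>_simps inverse field_simps)
      then have "\<sigma> (inverse ?a0 * a ! i) \<in> M" if "i < n" for i
        using M(8)[OF w(2)[OF that] w(2)[OF n0]] by simp
      then show ?thesis by (auto simp: cs_def S_def in_set_conv_nth)
    qed
    ultimately have "set (qpfister p bs) \<subseteq> S" using bs(1) by (intro F.qpfister_subset_subfield) auto
    \<comment> \<open>Isotropy over the function field lets fewer than \<open>n\<close> elements
      span \<open>W\<close>, which makes the dimension bound strict.\<close>
    moreover have "\<not> qf_anisotropic p (map \<sigma> a)"
      using \<xi>_isotropic \<xi>1_nonzero dim2 unfolding qf_anisotropic_def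
      by (intro notI) (auto dest!: spec[of _ \<xi>] spec[of _ 1])
    then obtain B where B: "W = L.V B" "length B < n" using L.not_aniso_redundant by fastforce
    have "M \<subseteq> L.V (map ((*) (inverse (\<sigma> ?a0))) B)"
    proof
      fix x assume "x \<in> M"
      then have "x * \<sigma> ?a0 \<in> L.V B"
        using L.V_mem[of "\<sigma> ?a0" "map \<sigma> a"] n0 B(1) unfolding M_def by auto
      moreover have "x = inverse (\<sigma> ?a0) * (x * \<sigma> ?a0)" using \<sigma>a0 by simp
      ultimately show "x \<in> L.V (map ((*) (inverse (\<sigma> ?a0))) B)" unfolding L.V_map_mult by blast
    qed
    ultimately have "set (map \<sigma> (qpfister p bs)) \<subseteq> L.V (map ((*) (inverse (\<sigma> ?a0))) B)"
      unfolding S_def by auto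
    then have "length (qpfister p bs) \<le> p * length B" using length_le_p_times[OF bs(2)] by fastforce
    also have "\<dots> < p * n" using B(2) F.p_pos by simp
    finally show ?thesis .
  qed
  ultimately show ?thesis unfolding qp_neighbour_def using aniso a0 by blast
qed

subsection \<open>The multiplier field is large\<close>

text \<open>Each vector of a maximal independent isotropic family yields a multiplier
  \<open>ev (g k)\<close>. A dependence between these would give a relation divisible by the square
  of \<open>\<phi>\<close>, hence a neighbour.\<close>

lemma multipliers_of_relations:
  assumes "\<not> qp_neighbour p a"
  shows "\<exists>zs. qf_anisotropic p zs \<and> set zs \<subseteq> M \<and> length zs = qf_i0 p (map \<sigma> a)"
proof -
  define r where "r = qf_i0 p (map \<sigma> a)"
  obtain vs where indep: "lin_indep n r vs" and iso: "\<And>k. k < r \<Longrightarrow> qf_val p (map \<sigma> a) (vs k) = 0"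
    using qf_i0_attained[of "map \<sigma> a" p] by (auto simp: r_def)
  \<comment> \<open>Flattening the index pairs to \<open>k * n + j\<close> gives all coordinates of
    all vectors one denominator and one degree.\<close>
  obtain v d U where v: "homog {..<n} d v" "ev v \<noteq> 0"
    and U: "\<And>l. l < r * n \<Longrightarrow> homog {..<n} d (U l) \<and> vs (l div n) (l mod n) = ev (U l) / ev v"
    using common_denominator[of "r * n" "\<lambda>l. vs (l div n) (l mod n)" "{..<n}"] Fr_all by blast
  define u where "u k j = U (k * n + j)" for k j
  have u: "homog {..<n} d (u k j)" "ev (u k j) = ev v * vs k j" if "k < r" "j < n" for k j
  proof -
    have "k * n + j < Suc k * n" using that by simp
    also have "\<dots> \<le> r * n" using that by (intro mult_right_mono) auto
    finally show "homog {..<n} d (u k j)" "ev (u k j) = ev v * vs k j"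
      using U[of "k * n + j"] that v(2) div_nat_eqI[of n k "k * n + j"]
      by (auto simp: u_def mult.commute)
  qed
  have "\<exists>g. homog {..<n} (p * d - p) g \<and> F.form_poly a (u k) = \<phi> * g" if k: "k < r" for k
  proof -
    have P: "homog {..<n} (p * d) (F.form_poly a (u k))"
      using u(1)[OF k] by (rule F.homog_form_poly)
    have "ev (F.form_poly a (u k)) = qf_val p (map \<sigma> a) (\<lambda>j. ev v * vs k j)"
      unfolding ev_form_poly using u(2)[OF k] by (intro qf_val_cong) simp
    also have "\<dots> = 0" by (simp add: iso[OF k] flip: L.qf_val_scale)
    finally obtain g where "F.form_poly a (u k) = \<phi> ^ 1 * g" using ev_eq_0_iff[OF P] by (auto simp: dvd_def)
    from homog_quotient[OF P this] show ?thesis by simp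
  qed
  then obtain g where g: "\<And>k. k < r \<Longrightarrow> homog {..<n} (p * d - p) (g k)"
    "\<And>k. k < r \<Longrightarrow> F.form_poly a (u k) = \<phi> * g k" by metis
  define zs where "zs = map (\<lambda>k. ev (g k)) [0..<r]"
  have "qf_anisotropic p zs"
    unfolding qf_anisotropic_def
  proof (intro allI impI)
    fix c k assume c: "qf_val p zs c = 0" and k: "k < length zs"
    obtain e d' h where e: "homog {..<n} d' e" "ev e \<noteq> 0"
      and h: "\<And>k. k < r \<Longrightarrow> homog {..<n} d' (h k) \<and> c k = ev (h k) / ev e"
      using common_denominator[of r c "{..<n}"] Fr_all by blast
    have evh: "ev (h k) = ev e * c k" if "k < r" for k using h[OF that] e by simp
    \<comment> \<open>The dependence \<open>c\<close> says that \<open>G\<close> vanishes at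
      \<open>\<xi>\<close>, so a second factor \<open>\<phi>\<close> splits off.\<close>
    define G where "G = (\<Sum>k<r. h k ^ p * g k)"
    have "homog {..<n} (p * d' + (p * d - p)) G"
      unfolding G_def using h g(1) by (intro homog_sum homog_mult homog_power) auto
    moreover have "ev G = ev e ^ p * qf_val p zs c"
      by (simp add: G_def ev_simps evh zs_def qf_val_def sum_distrib_left power_mult_distrib ac_simps)
    ultimately have "\<phi> dvd G" using c ev_eq_0_iff by simp
    then obtain g' where g': "G = \<phi> * g'" by (auto simp: dvd_def)
    \<comment> \<open>The same combination of the lifted isotropic vectors; its form value is
      \<open>\<phi> * G\<close>.\<close>
    define f where "f j = (\<Sum>k<r. h k * u k j)" for j
    have f_homog: "homog {..<n} (d' + d) (f j)" if "j < n" for j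
      unfolding f_def using h u(1) that by (intro homog_sum homog_mult) auto
    have "F.form_poly a f = (\<Sum>k<r. h k ^ p * F.form_poly a (u k))"
      unfolding F.form_poly_def f_def F.frob_mpoly_sum power_mult_distrib sum_distrib_left
      by (subst sum.swap) (simp add: mult.left_commute)
    also have "\<dots> = \<phi> * G" unfolding G_def by (simp add: g(2) sum_distrib_left mult.left_commute)
    also have "\<dots> = \<phi>\<^sup>2 * g'" by (simp add: g' power2_eq_square mult.assoc)
    finally have double: "F.form_poly a f = \<phi>\<^sup>2 * g'" .
    have "ev (f j) = 0" if j: "j < n" for j
    proof (rule ccontr)
      assume "ev (f j) \<noteq> 0"
      from double_relation[OF f_homog double j this] obtain w
        where "w \<noteq> 0" "\<And>i. i < n \<Longrightarrow> w * \<sigma> (a ! i) \<in> M" by auto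
      from scaled_coefficients_in_M_imp_neighbour[OF this] assms show False by contradiction
    qed
    moreover have "ev (f j) = ev e * ev v * (\<Sum>k<r. c k * vs k j)" if "j < n" for j
      using u(2) that by (simp add: f_def ev_simps evh sum_distrib_left ac_simps)
    ultimately have "(\<Sum>k<r. c k * vs k j) = 0" if "j < n" for j using that e v by simp
    then show "c k = 0" using indep k by (simp add: lin_indep_def zs_def)
  qed
  moreover have "set zs \<subseteq> M" unfolding zs_def using multiplier_of_relation[OF g(2)] by auto
  ultimately show ?thesis by (auto simp: zs_def r_def intro!: exI[of _ zs])
qed

text \<open>An anisotropic \<open>s\<close>-fold Pfister form with slots in \<open>M\<close> has all
  its values in \<open>M\<close>, so \<open>W\<close> is a vector space over its value field; a
  basis of \<open>W\<close> gives the cofactor \<open>\<tau>\<close>.\<close>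

theorem first_kernel_divisible:
  assumes \<phi>1: "is_qform \<phi>1" "qf_anisotropic p \<phi>1" "qf_values p \<phi>1 = W"
    and s: "s = (LEAST t. qf_i0 p (map \<sigma> a) \<le> p ^ t)" and nb: "\<not> qp_neighbour p a"
  shows "\<exists>bs \<tau>. length bs = s \<and> is_qform \<tau> \<and> qf_isometric p \<phi>1 (qf_tensor (qpfister p bs) \<tau>)"
proof -
  obtain zs where zs: "qf_anisotropic p zs" "set zs \<subseteq> M" "length zs = qf_i0 p (map \<sigma> a)"
    using multipliers_of_relations[OF nb] by blast
  \<comment> \<open>Minimality of \<open>s\<close> supplies the strict inequalities needed to choose
    \<open>s\<close> slots one after another.\<close>
  have "p ^ i < length zs" if "i < s" for i
    using not_less_Least[of i "\<lambda>t. qf_i0 p (map \<sigma> a) \<le> p ^ t"] that zs(3) s by simp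
  then obtain bs where bs: "length bs = s" "set bs \<subseteq> M" "qf_anisotropic p (qpfister p bs)"
    using L.qpfister_in_subfield[OF M_subfield zs(1,2)] by blast
  have VM: "x \<in> M" if x: "x \<in> L.V (qpfister p bs)" for x
    using L.V_least[OF x L.qpfister_subset_subfield[OF M_subfield bs(2)]]
      subfield_closedD(1,3,4)[OF M_subfield] M_frob by blast
  then have "w * x \<in> L.V \<phi>1" if "x \<in> L.V (qpfister p bs)" "w \<in> L.V \<phi>1" for x w
    using that(2) VM[OF that(1)] \<phi>1(3) unfolding M_def by (subst mult.commute) auto
  then obtain \<tau> where \<tau>: "qf_anisotropic p (qf_tensor \<tau> (qpfister p bs))"
    "L.V (qf_tensor \<tau> (qpfister p bs)) = L.V \<phi>1"
    using L.field_list_module_basis[OF L.field_list_qpfister bs(3)] by blast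
  have "is_qform \<tau>"
  proof (rule ccontr)
    assume "\<not> is_qform \<tau>"
    then have "\<forall>x\<in>set \<tau>. x = 0" by (auto simp: is_qform_def)
    then have "set (qf_tensor \<tau> (qpfister p bs)) \<subseteq> {0}" by (auto simp: L.set_tensor)
    then have "x \<in> {0}" if "x \<in> L.V (qf_tensor \<tau> (qpfister p bs))" for x
      by (rule L.V_least[OF that]) auto
    then show False using \<phi>1(1) \<tau>(2) L.V_mem by (force simp: is_qform_def)
  qed
  moreover have "qf_isometric p \<phi>1 (qf_tensor (qpfister p bs) \<tau>)"
    using L.aniso_isometric[OF \<phi>1(2) L.aniso_tensor_commute[OF \<tau>(1)]] \<tau>(2)
      L.V_tensor_commute[of "qpfister p bs" \<tau>] by simp
  ultimately show ?thesis using bs(1) by blast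
qed

end

theorem mainTheorem3:
  fixes p s :: nat
    and a :: "'a::field list"
    and \<sigma> :: "'a \<Rightarrow> 'b::field"
    and \<xi> :: "nat \<Rightarrow> 'b"
    and \<phi>1 :: "'b list"
  assumes "prime p"
    and "CHAR('a) = p"
    and "is_qform a"
    and "qf_anisotropic p a"
    and "length a \<ge> 2"
    and "is_function_field p a \<sigma> \<xi>"
    and "is_qform \<phi>1" and "qf_anisotropic p \<phi>1"
    and "qf_values p \<phi>1 = qf_values p (map \<sigma> a)"
    and "s = (LEAST t. qf_i0 p (map \<sigma> a) \<le> p ^ t)"
    and "\<not> qp_neighbour p a"
  shows "\<exists>bs \<tau>. length bs = s \<and> is_qform \<tau> \<and>
           qf_isometric p \<phi>1 (qf_tensor (qpfister p bs) \<tau>)"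
proof -
  interpret function_field p a \<sigma> \<xi>
    by unfold_locales (use assms in auto)
  show ?thesis
    by (rule first_kernel_divisible) (use assms in auto)
qed

end
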